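(* Let $n\ge1$, let $0\le r,k\le n$, and let $\alpha\vdash r$ and $\beta\vdash k$ be two Young diagrams such that $r<|\beta|$. Then the $(\alpha,\beta)$ entry in the Cartan matrix of $\mathbb C\mathcal{PT}_n$ is $0$.
   Context: $\mathcal{PT}_n$ is the monoid of all partial functions on $\{1,\dots,n\}$, with functions composed from right to left. For a partition $\beta$, $|\beta|$ denotes its number of parts (number of rows of the Young diagram). The Cartan matrix of a $\mathbb C$-algebra $A$ with simple modules $S(1),\dots,S(r)$ (up to isomorphism) and indecomposable projective modules $P(1),\dots,P(r)$, where $P(i)$ is the projective cover of $S(i)$, is the $r\times r$ matrix whose $(i,j)$ entry is the number of times $S(i)$ appears as a Jordan–Hölder factor of $P(j)$. For $A=\mathbb C\mathcal{PT}_n$ the simple modules (hence rows and columns) are indexed by partitions $\alpha\vdash k$, $0\le k\le n$: $S(\alpha)=\mathbb C\mathcal L(\mathrm{id}_k)\bigotimes_{\mathbb CS_k}S^{\alpha}$ and $P(\alpha)=\mathbb C\widetilde{\mathcal L}_E(\mathrm{id}_k)\bigotimes_{\mathbb CS_k}S^{\alpha}$. Here $\mathrm{id}_k$ is the partial identity on $\{1,\dots,k\}$; $\mathcal L(\mathrm{id}_k)$ is its Green $\mathcal L$-class (injective partial functions with domain $\{1,\dots,k\}$); $\widetilde{\mathcal L}_E(\mathrm{id}_k)$ is the set of all partial functions in $\mathcal{PT}_n$ with domain $\{1,\dots,k\}$; for $X$ either set, $s\in\mathcal{PT}_n$ acts on $\mathbb CX$ by $s\cdot x=sx$ if $sx\in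 X$ and $0$ otherwise, and the symmetric group $S_k$ acts by right multiplication; $S^{\alpha}$ is the Specht module of $\mathbb CS_k$ indexed by $\alpha$ (with $S^{[k]}$ trivial). *)

theory Defs
  imports
    Complex_Main
    "HOL-Algebra.AbelCoset"
    "HOL-Algebra.Module"
    "HOL-Algebra.Sym_Groups"
    "HOL-Algebra.Free_Abelian_Groups"
begin

text \<open>
  The locale \<^locale>\<open>module\<close> of HOL-Algebra asks for a commutative ring of scalars. We only reuse
  its record type (whose fields \<open>mult\<close> and \<open>one\<close> are meaningless for modules and left undefined)
  and the locale \<^locale>\<open>submodule\<close>, which makes sense for left modules over any ring.
\<close>


section \<open>Left modules, composition factors, Cartan matrix\<close>

locale left_module = R?: ring R + M?: abelian_group M
  for R :: "('a, 'b) ring_scheme" and M :: "('a, 'm, 'c) module_scheme" (structure) +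
  assumes smult_closed: "\<lbrakk>a \<in> carrier R; x \<in> carrier M\<rbrakk> \<Longrightarrow> a \<odot>\<^bsub>M\<^esub> x \<in> carrier M"
    and smult_l_distr: "\<lbrakk>a \<in> carrier R; b \<in> carrier R; x \<in> carrier M\<rbrakk> \<Longrightarrow>
      (a \<oplus>\<^bsub>R\<^esub> b) \<odot>\<^bsub>M\<^esub> x = a \<odot>\<^bsub>M\<^esub> x \<oplus>\<^bsub>M\<^esub> b \<odot>\<^bsub>M\<^esub> x"
    and smult_r_distr: "\<lbrakk>a \<in> carrier R; x \<in> carrier M; y \<in> carrier M\<rbrakk> \<Longrightarrow>
      a \<odot>\<^bsub>M\<^esub> (x \<oplus>\<^bsub>M\<^esub> y) = a \<odot>\<^bsub>M\<^esub> x \<oplus>\<^bsub>M\<^esub> a \<odot>\<^bsub>M\<^esub> y"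
    and smult_assoc: "\<lbrakk>a \<in> carrier R; b \<in> carrier R; x \<in> carrier M\<rbrakk> \<Longrightarrow>
      (a \<otimes>\<^bsub>R\<^esub> b) \<odot>\<^bsub>M\<^esub> x = a \<odot>\<^bsub>M\<^esub> (b \<odot>\<^bsub>M\<^esub> x)"
    and smult_one: "x \<in> carrier M \<Longrightarrow> \<one>\<^bsub>R\<^esub> \<odot>\<^bsub>M\<^esub> x = x"

text \<open>\<open>a (x + N) = a x + N\<close> is computed as \<open>N + a (x + N)\<close>, which avoids choosing representatives.\<close>

definition quot_module :: "('a, 'm) module \<Rightarrow> 'm set \<Rightarrow> ('a, 'm set) module" where
  "quot_module M N =
     \<lparr>carrier = a_rcosets\<^bsub>M\<^esub> N, monoid.mult = undefined, one = undefined,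
      ring.zero = N, ring.add = set_add M,
      smult = (\<lambda>a C. N <+>\<^bsub>M\<^esub> ((\<lambda>x. a \<odot>\<^bsub>M\<^esub> x) ` C))\<rparr>"

definition simple_module :: "'a ring \<Rightarrow> ('a, 'm) module \<Rightarrow> bool" where
  "simple_module A M \<longleftrightarrow>
     left_module A M \<and> carrier M \<noteq> {\<zero>\<^bsub>M\<^esub>} \<and>
     (\<forall>N. submodule N A M \<longrightarrow> N = {\<zero>\<^bsub>M\<^esub>} \<or> N = carrier M)"

definition module_isomorphic :: "'a ring \<Rightarrow> ('a, 'm) module \<Rightarrow> ('a, 'n) module \<Rightarrow> bool" where
  "module_isomorphic A M N \<longleftrightarrow>
     (\<exists>h. h \<in> iso (add_monoid M) (add_monoid N) \<and>
          (\<forall>a \<in> carrier A. \<forall>x \<in> carrier M. h (a \<odot>\<^bsub>M\<^esub> x) = a \<odot>\<^bsub>N\<^esub> h x))"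

text \<open>The factor \<open>N\<^sub>i\<^sub>+\<^sub>1 / N\<^sub>i\<close> of a chain of submodules of \<open>M\<close>.\<close>

definition chain_factor :: "('a, 'm) module \<Rightarrow> 'm set list \<Rightarrow> nat \<Rightarrow> ('a, 'm set) module" where
  "chain_factor M Ns i = quot_module (M\<lparr>carrier := Ns ! Suc i\<rparr>) (Ns ! i)"

definition composition_series :: "'a ring \<Rightarrow> ('a, 'm) module \<Rightarrow> 'm set list \<Rightarrow> bool" where
  "composition_series A M Ns \<longleftrightarrow>
     Ns \<noteq> [] \<and> hd Ns = {\<zero>\<^bsub>M\<^esub>} \<and> last Ns = carrier M \<and>
     (\<forall>N \<in> set Ns. submodule N A M) \<and>
     (\<forall>i. Suc i < length Ns \<longrightarrow> Ns ! i \<subseteq> Ns ! Suc i \<and> simple_module A (chain_factor M Ns i))"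

text \<open>
  The number of times \<open>S\<close> appears as a factor of a composition series of a module \<open>M\<close> of finite
  length. By the Jordan--Hoelder theorem the chosen composition series does not matter.
\<close>

definition jh_multiplicity :: "'a ring \<Rightarrow> ('a, 's) module \<Rightarrow> ('a, 'm) module \<Rightarrow> nat" where
  "jh_multiplicity A S M =
     (let Ns = (SOME Ns. composition_series A M Ns)
      in card {i. Suc i < length Ns \<and> module_isomorphic A (chain_factor M Ns i) S})"

text \<open>
  The Cartan matrix with respect to representatives \<open>S i\<close> of the simple modules and their
  projective covers \<open>P i\<close>.
\<close>

definition cartan_matrix ::
    "'a ring \<Rightarrow> ('i \<Rightarrow> ('a, 's) module) \<Rightarrow> ('i \<Rightarrow> ('a, 'p) module) \<Rightarrow> 'i \<Rightarrow> 'i \<Rightarrow> nat" where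
  "cartan_matrix A S P i j = jh_multiplicity A (S i) (P j)"


section \<open>Tensor products\<close>

text \<open>
  \<open>M \<otimes> N\<close> over \<open>R\<close>, for a left \<open>A\<close>-module \<open>M\<close> with a commuting right \<open>R\<close>-action \<open>ract\<close> and a left
  \<open>R\<close>-module \<open>N\<close>: the free abelian group on \<open>M \<times> N\<close> modulo the usual relations, with
  \<open>a (m \<otimes> n) = (a m) \<otimes> n\<close>. The operators \<open>smult\<close> of \<open>tensor_free\<close> are additive but become an
  \<open>A\<close>-module structure only in the quotient.
\<close>

definition tensor_free ::
    "('a, 'm) module \<Rightarrow> ('r, 'n) module \<Rightarrow> ('a, ('m \<times> 'n) \<Rightarrow>\<^sub>0 int) module" where
  "tensor_free M N =
     \<lparr>carrier = carrier (free_Abelian_group (carrier M \<times> carrier N)),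
      monoid.mult = undefined, one = undefined, ring.zero = 0, ring.add = (+),
      smult = (\<lambda>a. frag_extend (\<lambda>(m, n). frag_of (a \<odot>\<^bsub>M\<^esub> m, n)))\<rparr>"

definition tensor_relations ::
    "'r ring \<Rightarrow> ('m \<Rightarrow> 'r \<Rightarrow> 'm) \<Rightarrow> ('a, 'm) module \<Rightarrow> ('r, 'n) module \<Rightarrow> (('m \<times> 'n) \<Rightarrow>\<^sub>0 int) set" where
  "tensor_relations R ract M N =
     {frag_of (m \<oplus>\<^bsub>M\<^esub> m', n) - frag_of (m, n) - frag_of (m', n) | m m' n.
        m \<in> carrier M \<and> m' \<in> carrier M \<and> n \<in> carrier N}
   \<union> {frag_of (m, n \<oplus>\<^bsub>N\<^esub> n') - frag_of (m, n) - frag_of (m, n') | m n n'.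
        m \<in> carrier M \<and> n \<in> carrier N \<and> n' \<in> carrier N}
   \<union> {frag_of (ract m s, n) - frag_of (m, s \<odot>\<^bsub>N\<^esub> n) | m s n.
        m \<in> carrier M \<and> s \<in> carrier R \<and> n \<in> carrier N}"

definition tensor_module ::
    "'r ring \<Rightarrow> ('m \<Rightarrow> 'r \<Rightarrow> 'm) \<Rightarrow> ('a, 'm) module \<Rightarrow> ('r, 'n) module
      \<Rightarrow> ('a, (('m \<times> 'n) \<Rightarrow>\<^sub>0 int) set) module" where
  "tensor_module R ract M N =
     quot_module (tensor_free M N)
       (generate (add_monoid (tensor_free M N)) (tensor_relations R ract M N))"


section \<open>Monoid algebras and linearized actions\<close>

text \<open>
  For finite \<open>M\<close> and \<open>X\<close>: the bilinear extension to \<open>\<complex>M \<times> \<complex>X\<close> of the rule \<open>s \<cdot> x = act s x\<close> if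
  \<open>act s x \<in> X\<close>, and \<open>s \<cdot> x = 0\<close> otherwise. Elements of \<open>\<complex>X\<close> are the functions vanishing off \<open>X\<close>.
\<close>

definition lin_act ::
    "('s, 'b) monoid_scheme \<Rightarrow> 'x set \<Rightarrow> ('s \<Rightarrow> 'x \<Rightarrow> 'x) \<Rightarrow> ('s \<Rightarrow> complex) \<Rightarrow> ('x \<Rightarrow> complex) \<Rightarrow> 'x \<Rightarrow> complex"
  where
  "lin_act M X act a v =
     (\<lambda>y. if y \<in> X
          then \<Sum>(s, x) \<in> {(s, x). s \<in> carrier M \<and> x \<in> X \<and> act s x = y}. a s * v x
          else 0)"

definition lin_module ::
    "('s, 'b) monoid_scheme \<Rightarrow> 'x set \<Rightarrow> ('s \<Rightarrow> 'x \<Rightarrow> 'x) \<Rightarrow> ('s \<Rightarrow> complex, 'x \<Rightarrow> complex) module" where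
  "lin_module M X act =
     \<lparr>carrier = {v. \<forall>x. x \<notin> X \<longrightarrow> v x = 0}, monoid.mult = undefined, one = undefined,
      ring.zero = (\<lambda>_. 0), ring.add = (\<lambda>v w x. v x + w x), smult = lin_act M X act\<rparr>"

definition monoid_algebra :: "('s, 'b) monoid_scheme \<Rightarrow> ('s \<Rightarrow> complex) ring" where
  "monoid_algebra M =
     \<lparr>carrier = {f. \<forall>x. x \<notin> carrier M \<longrightarrow> f x = 0},
      monoid.mult = lin_act M (carrier M) (monoid.mult M),
      one = (\<lambda>x. if x = \<one>\<^bsub>M\<^esub> then 1 else 0),
      ring.zero = (\<lambda>_. 0), ring.add = (\<lambda>f g x. f x + g x)\<rparr>"


section \<open>Specht modules\<close>

definition is_partition :: "nat list \<Rightarrow> nat \<Rightarrow> bool" where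
  "is_partition \<alpha> k \<longleftrightarrow> sorted_wrt (\<ge>) \<alpha> \<and> 0 \<notin> set \<alpha> \<and> sum_list \<alpha> = k"

definition young_diagram :: "nat list \<Rightarrow> (nat \<times> nat) set" where
  "young_diagram \<alpha> = {(i, j). i < length \<alpha> \<and> j < \<alpha> ! i}"

text \<open>A tableau is a filling of the diagram; its values outside of the diagram are irrelevant.\<close>

definition is_tableau :: "nat list \<Rightarrow> (nat \<times> nat \<Rightarrow> nat) \<Rightarrow> bool" where
  "is_tableau \<alpha> t \<longleftrightarrow> bij_betw t (young_diagram \<alpha>) {1..sum_list \<alpha>}"

definition tableau_row :: "nat list \<Rightarrow> (nat \<times> nat \<Rightarrow> nat) \<Rightarrow> nat \<Rightarrow> nat set" where
  "tableau_row \<alpha> t i = {t (i, j) | j. (i, j) \<in> young_diagram \<alpha>}"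

definition tableau_column :: "nat list \<Rightarrow> (nat \<times> nat \<Rightarrow> nat) \<Rightarrow> nat \<Rightarrow> nat set" where
  "tableau_column \<alpha> t j = {t (i, j) | i. (i, j) \<in> young_diagram \<alpha>}"

text \<open>
  Two tableaux are row equivalent iff they have the same sequence of row sets, so the tabloid of
  \<open>t\<close> is represented by this sequence.
\<close>

definition tabloid :: "nat list \<Rightarrow> (nat \<times> nat \<Rightarrow> nat) \<Rightarrow> nat \<Rightarrow> nat set" where
  "tabloid \<alpha> t = tableau_row \<alpha> t"

definition tabloids :: "nat list \<Rightarrow> (nat \<Rightarrow> nat set) set" where
  "tabloids \<alpha> = {tabloid \<alpha> t | t. is_tableau \<alpha> t}"

definition column_group :: "nat list \<Rightarrow> (nat \<times> nat \<Rightarrow> nat) \<Rightarrow> (nat \<Rightarrow> nat) set" where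
  "column_group \<alpha> t =
     {\<pi> \<in> carrier (sym_group (sum_list \<alpha>)). \<forall>j. \<pi> ` tableau_column \<alpha> t j = tableau_column \<alpha> t j}"

text \<open>The permutation module \<open>M\<^sup>\<alpha>\<close> of \<open>\<complex>S\<^sub>k\<close>, with basis the \<open>\<alpha>\<close>-tabloids.\<close>

definition tabloid_module :: "nat list \<Rightarrow> ((nat \<Rightarrow> nat) \<Rightarrow> complex, (nat \<Rightarrow> nat set) \<Rightarrow> complex) module" where
  "tabloid_module \<alpha> = lin_module (sym_group (sum_list \<alpha>)) (tabloids \<alpha>) (\<lambda>\<sigma> T i. \<sigma> ` T i)"

text \<open>\<open>e\<^sub>t\<close>, the sum over the column group of \<open>t\<close> of \<open>sgn \<pi>\<close> times the tabloid of \<open>\<pi> t\<close>.\<close>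

definition polytabloid :: "nat list \<Rightarrow> (nat \<times> nat \<Rightarrow> nat) \<Rightarrow> (nat \<Rightarrow> nat set) \<Rightarrow> complex" where
  "polytabloid \<alpha> t =
     (\<lambda>T. \<Sum>\<pi> \<in> column_group \<alpha> t. if tabloid \<alpha> (\<pi> \<circ> t) = T then of_int (sign \<pi>) else 0)"

definition polytabloids :: "nat list \<Rightarrow> ((nat \<Rightarrow> nat set) \<Rightarrow> complex) set" where
  "polytabloids \<alpha> = {polytabloid \<alpha> t | t. is_tableau \<alpha> t}"

text \<open>The Specht module is the complex span of the polytabloids in \<open>M\<^sup>\<alpha>\<close>.\<close>

definition specht_module :: "nat list \<Rightarrow> ((nat \<Rightarrow> nat) \<Rightarrow> complex, (nat \<Rightarrow> nat set) \<Rightarrow> complex) module" where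
  "specht_module \<alpha> =
     (tabloid_module \<alpha>)
       \<lparr>carrier := {(\<lambda>T. \<Sum>e \<in> F. c e * e T) | F c. finite F \<and> F \<subseteq> polytabloids \<alpha>}\<rparr>"


section \<open>The monoid of partial functions and its modules\<close>

definition partial_fun_monoid :: "nat \<Rightarrow> (nat \<rightharpoonup> nat) monoid" where
  "partial_fun_monoid n =
     \<lparr>carrier = {f. dom f \<subseteq> {1..n} \<and> ran f \<subseteq> {1..n}}, monoid.mult = (\<circ>\<^sub>m), one = Some |` {1..n}\<rparr>"

text \<open>The Green class of \<open>x\<close>: elements generating the same principal left ideal.\<close>

definition green_L_class :: "('s, 'b) monoid_scheme \<Rightarrow> 's \<Rightarrow> 's set" where
  "green_L_class M x =
     {y \<in> carrier M. {s \<otimes>\<^bsub>M\<^esub> y | s. s \<in> carrier M} = {s \<otimes>\<^bsub>M\<^esub> x | s. s \<in> carrier M}}"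

definition partial_id :: "nat \<Rightarrow> (nat \<rightharpoonup> nat)" where
  "partial_id k = Some |` {1..k}"

definition L_class_id :: "nat \<Rightarrow> nat \<Rightarrow> (nat \<rightharpoonup> nat) set" where
  "L_class_id n k = green_L_class (partial_fun_monoid n) (partial_id k)"

definition L_tilde_class_id :: "nat \<Rightarrow> nat \<Rightarrow> (nat \<rightharpoonup> nat) set" where
  "L_tilde_class_id n k = {f \<in> carrier (partial_fun_monoid n). dom f = {1..k}}"

text \<open>
  The induced module \<open>\<complex>X \<otimes> S\<^sup>\<alpha>\<close> over \<open>\<complex>S\<^sub>k\<close> with \<open>\<alpha> \<turnstile> k\<close>. On \<open>X\<close>, a set of partial functions with
  domain \<open>{1..k}\<close>, \<open>\<sigma> \<in> S\<^sub>k\<close> acts from the right by \<open>x \<mapsto> x \<circ> \<sigma>\<close>.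
\<close>

definition induced_module ::
    "nat \<Rightarrow> (nat \<rightharpoonup> nat) set \<Rightarrow> nat list \<Rightarrow>
     ((nat \<rightharpoonup> nat) \<Rightarrow> complex,
      ((((nat \<rightharpoonup> nat) \<Rightarrow> complex) \<times> ((nat \<Rightarrow> nat set) \<Rightarrow> complex)) \<Rightarrow>\<^sub>0 int) set) module" where
  "induced_module n X \<alpha> =
     tensor_module
       (monoid_algebra (sym_group (sum_list \<alpha>)))
       (\<lambda>v a. lin_act (sym_group (sum_list \<alpha>)) X (\<lambda>\<sigma> x. x \<circ> \<sigma>) a v)
       (lin_module (partial_fun_monoid n) X (\<circ>\<^sub>m))
       (specht_module \<alpha>)"

definition PT_simple where
  "PT_simple n \<alpha> = induced_module n (L_class_id n (sum_list \<alpha>)) \<alpha>"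

definition PT_projective where
  "PT_projective n \<alpha> = induced_module n (L_tilde_class_id n (sum_list \<alpha>)) \<alpha>"

definition PT_cartan_matrix :: "nat \<Rightarrow> nat list \<Rightarrow> nat list \<Rightarrow> nat" where
  "PT_cartan_matrix n =
     cartan_matrix (monoid_algebra (partial_fun_monoid n)) (PT_simple n) (PT_projective n)"

end

theory Submission
  imports Defs "HOL-Library.Function_Algebras"
begin

text \<open>
  Let \<open>E = id\<^sub>r\<close>. It annihilates \<open>P(\<beta>)\<close>: this module is spanned by the \<open>f \<otimes> e\<^sub>t\<close> with \<open>f\<close> of domain
  \<open>{1..k}\<close> and \<open>e\<^sub>t\<close> a polytabloid, and \<open>E f\<close> acts as zero unless its image lies in \<open>{1..r}\<close>. In that
  case, as \<open>r < |\<beta>|\<close>, some two entries \<open>a\<close>, \<open>b\<close> of the first column of \<open>t\<close> have the same image under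
  \<open>f\<close>, so that \<open>f \<otimes> e\<^sub>t = f (a b) \<otimes> e\<^sub>t = f \<otimes> (a b) e\<^sub>t = - f \<otimes> e\<^sub>t\<close>. Hence \<open>E\<close> annihilates every
  composition factor of \<open>P(\<beta>)\<close>. But \<open>S(\<alpha>)\<close> is generated by the vectors \<open>id\<^sub>r \<otimes> u\<close>, which \<open>E\<close> fixes,
  so \<open>S(\<alpha>)\<close> would be zero if it were such a factor. As the multiplicity refers to a chosen composition
  series, one also needs that some composition series exists, which holds by finite dimension.
\<close>

section \<open>Quotients and composition series of left modules\<close>

text \<open>The two sides are treated unequally. P(\<beta>) has to become a genuine left module,
  because the chain argument for its composition series takes place there. S(\<alpha>) enters only
  as the target of an isomorphism from a composition factor \<open>C\<close>, and whatever is needed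
  of its action is carried over from \<open>C\<close> along that isomorphism
  (\<open>trivial_if_annihilated\<close>). The tensor product is a quotient of a free abelian group,
  so complex scalars are not part of its construction. A scalar \<open>c\<close> crosses the tensor
  sign because \<open>c\<close> times the identity permutation lies in the group algebra of S_k.
  This reduces every pure tensor to sums of tensors of a scaled basis function with a polytabloid.
  Annihilation by E and finite dimension of P(\<beta>) are two instances of this one reduction
  (\<open>pure_mem_if_span\<close>). For the same reason the sign argument by itself yields only 2
  (f \<otimes> e_t) = 0, and the coefficient of f has to be halved beforehand.\<close>

context left_module
begin

lemma smult_l_zero: assumes "x \<in> carrier M" shows "\<zero>\<^bsub>R\<^esub> \<odot>\<^bsub>M\<^esub> x = \<zero>\<^bsub>M\<^esub>"
proof -
  have "\<zero>\<^bsub>R\<^esub> \<odot>\<^bsub>M\<^esub> x \<oplus>\<^bsub>M\<^esub> \<zero>\<^bsub>R\<^esub> \<odot>\<^bsub>M\<^esub> x = \<zero>\<^bsub>R\<^esub> \<odot>\<^bsub>M\<^esub> x"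
    using smult_l_distr[of "\<zero>\<^bsub>R\<^esub>" "\<zero>\<^bsub>R\<^esub>" x] assms by simp
  then show ?thesis
    using smult_closed[of "\<zero>\<^bsub>R\<^esub>" x] assms M.add.l_cancel_one by simp
qed

lemma smult_r_zero: assumes "a \<in> carrier R" shows "a \<odot>\<^bsub>M\<^esub> \<zero>\<^bsub>M\<^esub> = \<zero>\<^bsub>M\<^esub>"
proof -
  have "a \<odot>\<^bsub>M\<^esub> \<zero>\<^bsub>M\<^esub> \<oplus>\<^bsub>M\<^esub> a \<odot>\<^bsub>M\<^esub> \<zero>\<^bsub>M\<^esub> = a \<odot>\<^bsub>M\<^esub> \<zero>\<^bsub>M\<^esub>"
    using smult_r_distr[of a "\<zero>\<^bsub>M\<^esub>" "\<zero>\<^bsub>M\<^esub>"] assms by simp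
  then show ?thesis
    using smult_closed[of a "\<zero>\<^bsub>M\<^esub>"] assms M.add.l_cancel_one by simp
qed

lemma smult_minus_one: assumes "x \<in> carrier M" shows "(\<ominus>\<^bsub>R\<^esub> \<one>\<^bsub>R\<^esub>) \<odot>\<^bsub>M\<^esub> x = \<ominus>\<^bsub>M\<^esub> x"
proof -
  have "(\<ominus>\<^bsub>R\<^esub> \<one>\<^bsub>R\<^esub>) \<odot>\<^bsub>M\<^esub> x \<oplus>\<^bsub>M\<^esub> x = \<zero>\<^bsub>M\<^esub>"
    using smult_l_distr[of "\<ominus>\<^bsub>R\<^esub> \<one>\<^bsub>R\<^esub>" "\<one>\<^bsub>R\<^esub>" x] assms by (simp add: R.l_neg smult_one smult_l_zero)
  then show ?thesis
    using smult_closed[of "\<ominus>\<^bsub>R\<^esub> \<one>\<^bsub>R\<^esub>" x] assms by (simp add: M.minus_equality)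
qed

text \<open>Negatives come from the action of the scalar -1, which is why closure under them is
  absent from the premises.\<close>

lemma submoduleI:
  assumes "K \<subseteq> carrier M" "\<zero>\<^bsub>M\<^esub> \<in> K"
    and "\<And>x y. x \<in> K \<Longrightarrow> y \<in> K \<Longrightarrow> x \<oplus>\<^bsub>M\<^esub> y \<in> K"
    and "\<And>a x. a \<in> carrier R \<Longrightarrow> x \<in> K \<Longrightarrow> a \<odot>\<^bsub>M\<^esub> x \<in> K"
  shows "submodule K R M"
proof (intro submodule.intro subgroup.intro)
  show "submodule_axioms K R M" using assms by unfold_locales
  fix x assume x: "x \<in> K"
  then have "\<ominus>\<^bsub>M\<^esub> x \<in> K"
    using smult_minus_one[of x] assms(1) assms(4)[OF _ x, of "\<ominus>\<^bsub>R\<^esub> \<one>\<^bsub>R\<^esub>"] by auto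
  then show "inv\<^bsub>add_monoid M\<^esub> x \<in> K" by (simp add: a_inv_def)
qed (use assms in auto)

lemma submodule_subset: "submodule K R M \<Longrightarrow> K \<subseteq> carrier M"
  using subgroup.subset[OF submodule.axioms(1)] by fastforce

lemma submodule_zero: "submodule K R M \<Longrightarrow> \<zero>\<^bsub>M\<^esub> \<in> K"
  using subgroup.one_closed[OF submodule.axioms(1)] by fastforce

lemma submodule_add: "submodule K R M \<Longrightarrow> x \<in> K \<Longrightarrow> y \<in> K \<Longrightarrow> x \<oplus>\<^bsub>M\<^esub> y \<in> K"
  using subgroup.m_closed[OF submodule.axioms(1)] by fastforce

lemma submodule_zero_set: "submodule {\<zero>\<^bsub>M\<^esub>} R M"
  by (rule submoduleI) (auto simp: smult_r_zero)

lemma submodule_carrier: "submodule (carrier M) R M"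
  by (rule submoduleI) (auto simp: smult_closed)

lemma left_module_submodule:
  assumes K: "submodule K R M"
  shows "left_module R (M\<lparr>carrier := K\<rparr>)"
proof -
  note sub = submodule_subset[OF K]
  have "abelian_group (M\<lparr>carrier := K\<rparr>)"
  proof (rule abelian_groupI)
    fix x assume x: "x \<in> carrier (M\<lparr>carrier := K\<rparr>)"
    have "\<ominus>\<^bsub>M\<^esub> x \<in> K"
      using x sub smult_minus_one[of x] submodule.smult_closed[OF K, of "\<ominus>\<^bsub>R\<^esub> \<one>\<^bsub>R\<^esub>" x] by auto
    moreover have "\<ominus>\<^bsub>M\<^esub> x \<oplus>\<^bsub>M\<^esub> x = \<zero>\<^bsub>M\<^esub>" using x sub M.l_neg by auto
    ultimately show "\<exists>y\<in>carrier (M\<lparr>carrier := K\<rparr>). y \<oplus>\<^bsub>M\<lparr>carrier := K\<rparr>\<^esub> x = \<zero>\<^bsub>M\<lparr>carrier := K\<rparr>\<^esub>" by auto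
  qed (use sub submodule_zero[OF K] submodule_add[OF K] in \<open>auto simp: subset_iff M.a_ac\<close>)
  then show ?thesis
    using sub submodule.smult_closed[OF K]
    by (intro left_module.intro left_module_axioms.intro R.ring_axioms)
      (auto simp: subset_iff smult_l_distr smult_r_distr smult_assoc smult_one)
qed

end

section \<open>Quotients by subgroups stable under an action\<close>

locale stable_subgroup = abelian_subgroup N M
  for A :: "('a, 'b) ring_scheme" and N and M :: "('a, 'm) module" (structure) +
  assumes act_closed: "\<lbrakk>a \<in> carrier A; x \<in> carrier M\<rbrakk> \<Longrightarrow> a \<odot> x \<in> carrier M"
    and act_stable: "\<lbrakk>a \<in> carrier A; x \<in> N\<rbrakk> \<Longrightarrow> a \<odot> x \<in> N"
    and act_add: "\<lbrakk>a \<in> carrier A; x \<in> carrier M; y \<in> carrier M\<rbrakk> \<Longrightarrow> a \<odot> (x \<oplus> y) = a \<odot> x \<oplus> a \<odot> y"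
begin

lemma carrier_quot: "carrier (quot_module M N) = (\<lambda>x. N +> x) ` carrier M"
  by (auto simp: quot_module_def A_RCOSETS_def')

lemma zero_quot: "\<zero>\<^bsub>quot_module M N\<^esub> = N"
  by (simp add: quot_module_def)

lemma add_quot:
  assumes "x \<in> carrier M" "y \<in> carrier M"
  shows "(N +> x) \<oplus>\<^bsub>quot_module M N\<^esub> (N +> y) = N +> (x \<oplus> y)"
  using a_rcos_sum[OF assms] by (simp add: quot_module_def)

lemma coset_eq_N: "x \<in> carrier M \<Longrightarrow> N +> x = N \<longleftrightarrow> x \<in> N"
  using a_coset_join1 a_coset_join2 a_subgroup by blast

lemma smult_quot:
  assumes a: "a \<in> carrier A" and x: "x \<in> carrier M"
  shows "a \<odot>\<^bsub>quot_module M N\<^esub> (N +> x) = N +> (a \<odot> x)"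
proof -
  have N: "y \<in> carrier M" if "y \<in> N" for y using that a_subset by blast
  \<comment> \<open>\<open>N + a (N + x)\<close> is a single coset: the excess \<open>a v\<close> is
    absorbed into \<open>N\<close>, and \<open>v = \<zero>\<close> gives the converse
    inclusion.\<close>
  have "\<exists>h\<in>N. u \<oplus> a \<odot> (v \<oplus> x) = h \<oplus> a \<odot> x" if "u \<in> N" "v \<in> N" for u v
    using that a x by (intro bexI[of _ "u \<oplus> a \<odot> v"]) (auto simp: act_add act_closed act_stable N a_assoc)
  moreover have "\<exists>v\<in>N. u \<oplus> a \<odot> x = u \<oplus> a \<odot> (v \<oplus> x)" for u
    using x by (intro bexI[of _ \<zero>]) auto
  ultimately show ?thesis
    by (auto simp: quot_module_def set_add_def' a_r_coset_def')
qed

text \<open>The laws are demanded only between cosets because two kinds of quotient are served: a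
  module by a submodule, where the laws hold before passing to cosets, and
  \<open>tensor_free\<close> by its relations, where additivity in the scalar holds only
  afterwards.\<close>

lemma left_module_quot:
  assumes A: "ring A"
    and l_distr: "\<And>a b x. \<lbrakk>a \<in> carrier A; b \<in> carrier A; x \<in> carrier M\<rbrakk> \<Longrightarrow>
      N +> ((a \<oplus>\<^bsub>A\<^esub> b) \<odot> x) = N +> (a \<odot> x \<oplus> b \<odot> x)"
    and assoc: "\<And>a b x. \<lbrakk>a \<in> carrier A; b \<in> carrier A; x \<in> carrier M\<rbrakk> \<Longrightarrow>
      N +> ((a \<otimes>\<^bsub>A\<^esub> b) \<odot> x) = N +> (a \<odot> (b \<odot> x))"
    and one: "\<And>x. x \<in> carrier M \<Longrightarrow> N +> (\<one>\<^bsub>A\<^esub> \<odot> x) = N +> x"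
  shows "left_module A (quot_module M N)"
proof -
  interpret A: ring A by fact
  have "abelian_group (quot_module M N)"
  proof (rule abelian_groupI)
    fix C assume "C \<in> carrier (quot_module M N)"
    then obtain x where x: "x \<in> carrier M" "C = N +> x" by (auto simp: carrier_quot)
    then show "\<exists>D\<in>carrier (quot_module M N). D \<oplus>\<^bsub>quot_module M N\<^esub> C = \<zero>\<^bsub>quot_module M N\<^esub>"
      by (intro bexI[of _ "N +> \<ominus> x"]) (auto simp: add_quot carrier_quot zero_quot l_neg coset_eq_N)
    show "\<zero>\<^bsub>quot_module M N\<^esub> \<oplus>\<^bsub>quot_module M N\<^esub> C = C"
      using x add_quot[of \<zero> x] coset_eq_N[of \<zero>] by (simp add: zero_quot)
  next
    have "N = N +> \<zero>" using coset_eq_N[of \<zero>] by simp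
    then show "\<zero>\<^bsub>quot_module M N\<^esub> \<in> carrier (quot_module M N)"
      by (auto simp: zero_quot carrier_quot)
  qed (auto simp: carrier_quot add_quot a_ac)
  then show ?thesis
    using A
    by (intro left_module.intro left_module_axioms.intro)
      (auto simp: carrier_quot smult_quot add_quot act_closed l_distr assoc one act_add)
qed

end

lemma stable_subgroup_submodule:
  assumes "left_module A M" and N: "submodule N A M"
  shows "stable_subgroup A N M"
proof -
  interpret left_module A M by fact
  show ?thesis
    by (intro stable_subgroup.intro abelian_subgroupI3 additive_subgroupI submodule.axioms(1)[OF N]
        M.abelian_group_axioms stable_subgroup_axioms.intro)
      (auto simp: smult_closed smult_r_distr submodule.smult_closed[OF N])
qed

text \<open>Correspondence theorem: a submodule of the quotient is the image of its preimage
  \<open>K\<close>, and maximality leaves only two choices for \<open>K\<close>.\<close>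

lemma simple_module_quot:
  assumes M: "left_module A M" and N: "submodule N A M" and ne: "N \<noteq> carrier M"
    and maximal: "\<And>K. submodule K A M \<Longrightarrow> N \<subseteq> K \<Longrightarrow> K = N \<or> K = carrier M"
  shows "simple_module A (quot_module M N)"
proof -
  interpret left_module A M by fact
  interpret stable_subgroup A N M by (rule stable_subgroup_submodule) fact+
  let ?Q = "quot_module M N"
  have Q: "left_module A ?Q"
    by (rule left_module_quot) (auto simp: R.ring_axioms smult_l_distr smult_assoc smult_one)
  interpret Q: left_module A ?Q by fact
  have "carrier ?Q \<noteq> {\<zero>\<^bsub>?Q\<^esub>}"
  proof
    assume *: "carrier ?Q = {\<zero>\<^bsub>?Q\<^esub>}"
    have "x \<in> N" if "x \<in> carrier M" for x
      using * that coset_eq_N[of x] by (auto simp: carrier_quot zero_quot)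
    then show False using ne a_subset by blast
  qed
  moreover have "L = {\<zero>\<^bsub>?Q\<^esub>} \<or> L = carrier ?Q" if L: "submodule L A ?Q" for L
  proof -
    define K where "K = {x \<in> carrier M. N +>\<^bsub>M\<^esub> x \<in> L}"
    have coset: "N +>\<^bsub>M\<^esub> x = N" if "x \<in> N" for x using that a_subset coset_eq_N[of x] by auto
    have NL: "N \<in> L" using Q.submodule_zero[OF L] by (simp add: zero_quot)
    have LQ: "L = (\<lambda>x. N +>\<^bsub>M\<^esub> x) ` K"
      using Q.submodule_subset[OF L] by (auto simp: K_def carrier_quot)
    have "submodule K A M"
    proof (rule submoduleI)
      show "\<zero>\<^bsub>M\<^esub> \<in> K" using NL coset[of "\<zero>\<^bsub>M\<^esub>"] by (simp add: K_def)
      show "x \<oplus>\<^bsub>M\<^esub> y \<in> K" if "x \<in> K" "y \<in> K" for x y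
        using that Q.submodule_add[OF L, of "N +>\<^bsub>M\<^esub> x" "N +>\<^bsub>M\<^esub> y"] by (simp add: K_def add_quot)
      show "a \<odot>\<^bsub>M\<^esub> x \<in> K" if "a \<in> carrier A" "x \<in> K" for a x
        using that submodule.smult_closed[OF L, of a "N +>\<^bsub>M\<^esub> x"]
        by (simp add: K_def smult_quot act_closed)
    qed (auto simp: K_def)
    moreover have "N \<subseteq> K" using NL coset a_subset by (auto simp: K_def)
    ultimately have "K = N \<or> K = carrier M" by (rule maximal)
    then show ?thesis
    proof
      assume "K = N"
      moreover have "N \<noteq> {}" using submodule_zero[OF N] by blast
      ultimately have "L = {N}" using LQ coset by auto
      then show ?thesis by (simp add: zero_quot)
    qed (use LQ in \<open>simp add: carrier_quot\<close>)
  qed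
  ultimately show ?thesis using Q by (simp add: simple_module_def)
qed

section \<open>Existence of composition series\<close>

lemma submodule_restrict:
  assumes M: "left_module A M" and L: "submodule L A M" and K: "submodule K A M" and "K \<subseteq> L"
  shows "submodule K A (M\<lparr>carrier := L\<rparr>)"
proof -
  interpret left_module A M by fact
  interpret L: left_module A "M\<lparr>carrier := L\<rparr>" by (rule left_module_submodule[OF L])
  show ?thesis
    by (rule L.submoduleI)
      (use assms submodule_zero[OF K] submodule_add[OF K] submodule.smult_closed[OF K] in auto)
qed

lemma submodule_unrestrict:
  assumes M: "left_module A M" and L: "submodule L A M" and K: "submodule K A (M\<lparr>carrier := L\<rparr>)"
  shows "submodule K A M"
proof -
  interpret left_module A M by fact
  interpret L: left_module A "M\<lparr>carrier := L\<rparr>" by (rule left_module_submodule[OF L])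
  show ?thesis
    by (rule submoduleI)
      (use submodule_subset[OF L] L.submodule_subset[OF K] L.submodule_zero[OF K] L.submodule_add[OF K]
        submodule.smult_closed[OF K] in auto)
qed

text \<open>The strictly monotone \<open>d\<close> stands in for the dimension. Since
  \<open>d L\<close> bounds it on the proper submodules of \<open>L\<close>, one of these has the
  greatest value; nothing fits strictly between it and \<open>L\<close>, and the induction continues
  below it.\<close>

lemma composition_series_exists:
  fixes d :: "'m set \<Rightarrow> nat"
  assumes M: "left_module A M"
    and d: "\<And>K L. submodule K A M \<Longrightarrow> submodule L A M \<Longrightarrow> K \<subset> L \<Longrightarrow> d K < d L"
  shows "\<exists>Ns. composition_series A M Ns"
proof -
  interpret left_module A M by fact
  \<comment> \<open>Series of submodules \<open>L\<close> are formed inside the fixed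
    \<open>M\<close>. As \<open>chain_factor\<close> overwrites the carrier, the factors of a series
    found for \<open>K\<close> are kept unchanged when \<open>L\<close> is appended.\<close>
  have "\<exists>Ns. Ns \<noteq> [] \<and> hd Ns = {\<zero>\<^bsub>M\<^esub>} \<and> last Ns = L \<and> (\<forall>N \<in> set Ns. submodule N A M) \<and>
     (\<forall>i. Suc i < length Ns \<longrightarrow> Ns ! i \<subseteq> Ns ! Suc i \<and> simple_module A (chain_factor M Ns i))"
    if "submodule L A M" for L
    using that
  proof (induction "d L" arbitrary: L rule: less_induct)
    case less
    note L = less.prems
    show ?case
    proof (cases "L = {\<zero>\<^bsub>M\<^esub>}")
      case True
      then show ?thesis using L by (intro exI[of _ "[L]"]) auto
    next
      case False
      define X where "X = {K. submodule K A M \<and> K \<subset> L}"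
      have "{\<zero>\<^bsub>M\<^esub>} \<in> X" using False submodule_zero_set submodule_zero[OF L] by (auto simp: X_def)
      moreover have "d K < d L" if "K \<in> X" for K using that d L by (auto simp: X_def)
      ultimately obtain K where K: "K \<in> X" and Kmax: "\<And>K'. K' \<in> X \<Longrightarrow> d K' \<le> d K"
        using ex_has_greatest_nat[of "\<lambda>K. K \<in> X" "{\<zero>\<^bsub>M\<^esub>}" d "d L"] by (auto intro: less_imp_le)
      then have KM: "submodule K A M" and KL: "K \<subset> L" by (auto simp: X_def)
      obtain Ns where Ns: "Ns \<noteq> []" "hd Ns = {\<zero>\<^bsub>M\<^esub>}" "last Ns = K" "\<forall>N \<in> set Ns. submodule N A M"
        "\<forall>i. Suc i < length Ns \<longrightarrow> Ns ! i \<subseteq> Ns ! Suc i \<and> simple_module A (chain_factor M Ns i)"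
        using less.hyps[OF d[OF KM L KL] KM] by blast
      have simple: "simple_module A (quot_module (M\<lparr>carrier := L\<rparr>) K)"
      proof (rule simple_module_quot)
        show "left_module A (M\<lparr>carrier := L\<rparr>)" by (rule left_module_submodule[OF L])
        show "submodule K A (M\<lparr>carrier := L\<rparr>)" using submodule_restrict[OF M L KM] KL by blast
        fix K' assume K': "submodule K' A (M\<lparr>carrier := L\<rparr>)" "K \<subseteq> K'"
        have K'M: "submodule K' A M" using submodule_unrestrict[OF M L K'(1)] .
        have K'L: "K' \<subseteq> L"
          using left_module.submodule_subset[OF left_module_submodule[OF L] K'(1)] by simp
        show "K' = K \<or> K' = carrier (M\<lparr>carrier := L\<rparr>)"
        proof (rule ccontr)
          assume *: "\<not> ?thesis"
          then have "K' \<in> X" using K'L K'M by (auto simp: X_def)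
          then have "d K' \<le> d K" by (rule Kmax)
          moreover have "d K < d K'" using d[OF KM K'M] * K'(2) by auto
          ultimately show False by simp
        qed
      qed (use KL in auto)
      have lst: "Ns ! (length Ns - Suc 0) = K" using Ns(1,3) by (simp add: last_conv_nth)
      have "(Ns @ [L]) ! i \<subseteq> (Ns @ [L]) ! Suc i \<and> simple_module A (chain_factor M (Ns @ [L]) i)"
        if "Suc i < length (Ns @ [L])" for i
      proof (cases "Suc i < length Ns")
        case True
        then show ?thesis using Ns(5) by (simp add: nth_append chain_factor_def)
      next
        case False
        then have "i = length Ns - Suc 0" "Suc i = length Ns" using that by auto
        then show ?thesis using lst KL simple Ns(1) by (auto simp: nth_append chain_factor_def)
      qed
      then show ?thesis using Ns L by (intro exI[of _ "Ns @ [L]"]) auto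
    qed
  qed
  from this[OF submodule_carrier] show ?thesis unfolding composition_series_def .
qed

section \<open>Dimension counting with a field of scalars inside the ring\<close>

locale field_module = left_module R M for R (structure) and M :: "('a, 'm, 'c) module_scheme" +
  fixes F :: "'k :: field \<Rightarrow> 'a"
  assumes F_closed: "F c \<in> carrier R"
    and F_add: "F (c + d) = F c \<oplus>\<^bsub>R\<^esub> F d"
    and F_mult: "F (c * d) = F c \<otimes>\<^bsub>R\<^esub> F d"
    and F_one: "F 1 = \<one>\<^bsub>R\<^esub>"
begin

primrec list_span :: "'m list \<Rightarrow> 'm set" where
  "list_span [] = {\<zero>\<^bsub>M\<^esub>}"
| "list_span (b # bs) = {F c \<odot>\<^bsub>M\<^esub> b \<oplus>\<^bsub>M\<^esub> y | c y. y \<in> list_span bs}"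

text \<open>The dimension of \<open>K \<inter> list_span bs\<close>, as the number of jumps along the flag of spans of the
  final segments of \<open>bs\<close>.\<close>

primrec span_rank :: "'m list \<Rightarrow> 'm set \<Rightarrow> nat" where
  "span_rank [] K = 0"
| "span_rank (b # bs) K =
     span_rank bs K + (if K \<inter> list_span (b # bs) \<subseteq> list_span bs then 0 else 1)"

lemma F_zero: "F 0 = \<zero>\<^bsub>R\<^esub>"
  using F_add[of 0 0] F_closed[of 0] R.add.l_cancel_one by simp

lemma smult_F_closed: "x \<in> carrier M \<Longrightarrow> F c \<odot>\<^bsub>M\<^esub> x \<in> carrier M"
  by (simp add: smult_closed F_closed)

lemma smult_F_add: "x \<in> carrier M \<Longrightarrow> F (c + d) \<odot>\<^bsub>M\<^esub> x = F c \<odot>\<^bsub>M\<^esub> x \<oplus>\<^bsub>M\<^esub> F d \<odot>\<^bsub>M\<^esub> x"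
  by (simp add: F_add F_closed smult_l_distr)

lemma smult_F_mult: "x \<in> carrier M \<Longrightarrow> F (c * d) \<odot>\<^bsub>M\<^esub> x = F c \<odot>\<^bsub>M\<^esub> (F d \<odot>\<^bsub>M\<^esub> x)"
  by (simp add: F_mult F_closed smult_assoc)

lemma smult_F_right_add: "x \<in> carrier M \<Longrightarrow> y \<in> carrier M \<Longrightarrow>
    F c \<odot>\<^bsub>M\<^esub> (x \<oplus>\<^bsub>M\<^esub> y) = F c \<odot>\<^bsub>M\<^esub> x \<oplus>\<^bsub>M\<^esub> F c \<odot>\<^bsub>M\<^esub> y"
  by (simp add: F_closed smult_r_distr)

lemma smult_F_zero: "x \<in> carrier M \<Longrightarrow> F 0 \<odot>\<^bsub>M\<^esub> x = \<zero>\<^bsub>M\<^esub>"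
  by (simp add: F_zero smult_l_zero)

lemma list_span_subset: "set bs \<subseteq> carrier M \<Longrightarrow> list_span bs \<subseteq> carrier M"
  by (induction bs) (auto simp: smult_F_closed)

lemma list_span_zero: "set bs \<subseteq> carrier M \<Longrightarrow> \<zero>\<^bsub>M\<^esub> \<in> list_span bs"
proof (induction bs)
  case (Cons b bs)
  then show ?case using smult_F_zero[of b] by (auto intro!: exI[of _ 0] exI[of _ "\<zero>\<^bsub>M\<^esub>"])
qed simp

lemma list_span_add:
  "set bs \<subseteq> carrier M \<Longrightarrow> x \<in> list_span bs \<Longrightarrow> y \<in> list_span bs \<Longrightarrow> x \<oplus>\<^bsub>M\<^esub> y \<in> list_span bs"
proof (induction bs arbitrary: x y)
  case (Cons b bs)
  then obtain c x' d y' where *: "x = F c \<odot>\<^bsub>M\<^esub> b \<oplus>\<^bsub>M\<^esub> x'" "y = F d \<odot>\<^bsub>M\<^esub> b \<oplus>\<^bsub>M\<^esub> y'"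
    "x' \<in> list_span bs" "y' \<in> list_span bs" by auto
  moreover have b: "b \<in> carrier M" using Cons.prems by simp
  moreover have "x' \<in> carrier M" "y' \<in> carrier M"
    using * list_span_subset[of bs] Cons.prems by auto
  ultimately have "x \<oplus>\<^bsub>M\<^esub> y = F (c + d) \<odot>\<^bsub>M\<^esub> b \<oplus>\<^bsub>M\<^esub> (x' \<oplus>\<^bsub>M\<^esub> y')"
    by (simp add: smult_F_add smult_F_closed M.a_ac)
  then show ?case using Cons * by auto
qed simp

lemma list_span_smult:
  "set bs \<subseteq> carrier M \<Longrightarrow> x \<in> list_span bs \<Longrightarrow> F c \<odot>\<^bsub>M\<^esub> x \<in> list_span bs"
proof (induction bs arbitrary: x)
  case (Cons b bs)
  then obtain d x' where *: "x = F d \<odot>\<^bsub>M\<^esub> b \<oplus>\<^bsub>M\<^esub> x'" "x' \<in> list_span bs" by auto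
  moreover have "b \<in> carrier M" "x' \<in> carrier M"
    using * list_span_subset[of bs] Cons.prems by auto
  ultimately have "F c \<odot>\<^bsub>M\<^esub> x = F (c * d) \<odot>\<^bsub>M\<^esub> b \<oplus>\<^bsub>M\<^esub> F c \<odot>\<^bsub>M\<^esub> x'"
    by (simp add: smult_F_mult smult_F_right_add smult_F_closed)
  then show ?case using Cons * by auto
qed (simp add: F_closed smult_r_zero)

lemma list_span_uminus:
  "set bs \<subseteq> carrier M \<Longrightarrow> x \<in> list_span bs \<Longrightarrow> \<ominus>\<^bsub>M\<^esub> x \<in> list_span bs"
proof -
  assume *: "set bs \<subseteq> carrier M" "x \<in> list_span bs"
  then have x: "x \<in> carrier M" using list_span_subset by auto
  have "F (- 1) \<odot>\<^bsub>M\<^esub> x \<oplus>\<^bsub>M\<^esub> x = F (- 1 + 1) \<odot>\<^bsub>M\<^esub> x"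
    using x by (simp only: smult_F_add) (simp add: F_one smult_one)
  then have "F (- 1) \<odot>\<^bsub>M\<^esub> x = \<ominus>\<^bsub>M\<^esub> x"
    using x by (simp add: smult_F_zero smult_F_closed M.minus_equality)
  then show ?thesis using list_span_smult[OF *, of "- 1"] by simp
qed

lemma list_span_base: "set bs \<subseteq> carrier M \<Longrightarrow> b \<in> set bs \<Longrightarrow> b \<in> list_span bs"
proof (induction bs)
  case (Cons a bs)
  show ?case
  proof (cases "b = a")
    case True
    then have "b = F 1 \<odot>\<^bsub>M\<^esub> a \<oplus>\<^bsub>M\<^esub> \<zero>\<^bsub>M\<^esub>" using Cons.prems by (simp add: F_one smult_one)
    then show ?thesis using list_span_zero[of bs] Cons.prems by auto
  next
    case False
    then have "b \<in> list_span bs" "b = F 0 \<odot>\<^bsub>M\<^esub> a \<oplus>\<^bsub>M\<^esub> b" using Cons by (auto simp: smult_F_zero)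
    then show ?thesis by auto
  qed
qed simp

lemma span_rank_mono:
  assumes "K \<subseteq> L"
  shows "span_rank bs K \<le> span_rank bs L"
  using assms by (induction bs) auto

text \<open>Gaussian elimination along the flag: if both submodules jump at \<open>b\<close>, an
  element \<open>y\<close> of \<open>K\<close> with nonzero \<open>b\<close>-coefficient clears that
  of any \<open>x\<close> in \<open>L\<close>, and the induction hypothesis applies to the
  remainder. Submodules are subspaces because each \<open>F t\<close> lies in the ring.\<close>

lemma span_rank_eq_imp_subset:
  assumes K: "submodule K R M" and L: "submodule L R M" and "K \<subseteq> L"
    and "set bs \<subseteq> carrier M" and "span_rank bs K = span_rank bs L"
  shows "L \<inter> list_span bs \<subseteq> K"
  using assms(4,5)
proof (induction bs)
  case Nil
  then show ?case using submodule_zero[OF K] by auto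
next
  case (Cons b bs)
  have b: "b \<in> carrier M" and bs: "set bs \<subseteq> carrier M" using Cons.prems by auto
  note sub = list_span_subset[OF bs]
  \<comment> \<open>Rank and jump are both monotone in the submodule, so equality of the sums forces
    equality of each summand.\<close>
  have "span_rank bs K = span_rank bs L"
    and jump: "K \<inter> list_span (b # bs) \<subseteq> list_span bs \<longleftrightarrow> L \<inter> list_span (b # bs) \<subseteq> list_span bs"
    using Cons.prems(2) span_rank_mono[OF \<open>K \<subseteq> L\<close>, of bs] \<open>K \<subseteq> L\<close>
    by (auto simp del: list_span.simps split: if_splits)
  then have IH: "L \<inter> list_span bs \<subseteq> K" using Cons.IH bs by simp
  show ?case
  proof (cases "L \<inter> list_span (b # bs) \<subseteq> list_span bs")
    case True
    then show ?thesis using IH by blast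
  next
    case False
    then obtain y where y: "y \<in> K" "y \<in> list_span (b # bs)" "y \<notin> list_span bs" using jump by blast
    then obtain c y' where y': "y = F c \<odot>\<^bsub>M\<^esub> b \<oplus>\<^bsub>M\<^esub> y'" "y' \<in> list_span bs" by auto
    have "c \<noteq> 0" using y(3) y' sub b by (auto simp: smult_F_zero)
    show ?thesis
    proof
      fix x assume x: "x \<in> L \<inter> list_span (b # bs)"
      then obtain d x' where x': "x = F d \<odot>\<^bsub>M\<^esub> b \<oplus>\<^bsub>M\<^esub> x'" "x' \<in> list_span bs" by auto
      \<comment> \<open>Chosen so that the \<open>b\<close>-coefficients of \<open>x\<close> and of
        \<open>s\<close> times \<open>y\<close> cancel. Afterwards \<open>x\<close> is recovered by
        adding \<open>- s\<close> times \<open>y\<close>, which stays in \<open>K\<close>.\<close>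
      define s where "s = - d / c"
      have s: "d + s * c = 0" using \<open>c \<noteq> 0\<close> by (simp add: s_def)
      have in_M: "x \<in> carrier M" "y \<in> carrier M" "x' \<in> carrier M" "y' \<in> carrier M"
        using x y x' y' sub submodule_subset[OF K] submodule_subset[OF L] by auto
      have *: "F t \<odot>\<^bsub>M\<^esub> y \<in> K" for t using y(1) submodule.smult_closed[OF K] F_closed by blast
      have "x \<oplus>\<^bsub>M\<^esub> F s \<odot>\<^bsub>M\<^esub> y
          = F (d + s * c) \<odot>\<^bsub>M\<^esub> b \<oplus>\<^bsub>M\<^esub> (x' \<oplus>\<^bsub>M\<^esub> F s \<odot>\<^bsub>M\<^esub> y')"
        using in_M b unfolding x'(1) y'(1)
        by (simp add: smult_F_add smult_F_mult smult_F_right_add smult_F_closed M.a_ac)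
      also have "\<dots> = x' \<oplus>\<^bsub>M\<^esub> F s \<odot>\<^bsub>M\<^esub> y'"
        using in_M b by (simp add: s smult_F_zero smult_F_closed)
      also have "\<dots> \<in> list_span bs" using x' y' list_span_add list_span_smult bs by blast
      finally have "x \<oplus>\<^bsub>M\<^esub> F s \<odot>\<^bsub>M\<^esub> y \<in> K"
        using submodule_add[OF L, of x "F s \<odot>\<^bsub>M\<^esub> y"] * x \<open>K \<subseteq> L\<close> IH by blast
      then have "(x \<oplus>\<^bsub>M\<^esub> F s \<odot>\<^bsub>M\<^esub> y) \<oplus>\<^bsub>M\<^esub> F (- s) \<odot>\<^bsub>M\<^esub> y \<in> K"
        using * submodule_add[OF K] by blast
      also have "(x \<oplus>\<^bsub>M\<^esub> F s \<odot>\<^bsub>M\<^esub> y) \<oplus>\<^bsub>M\<^esub> F (- s) \<odot>\<^bsub>M\<^esub> y = x \<oplus>\<^bsub>M\<^esub> F (s + - s) \<odot>\<^bsub>M\<^esub> y"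
        using in_M by (simp only: smult_F_add) (simp add: smult_F_closed M.a_assoc)
      also have "\<dots> = x" using in_M by (simp add: smult_F_zero)
      finally show "x \<in> K" .
    qed
  qed
qed

text \<open>For a spanning list this makes \<open>span_rank bs\<close> a measure of the kind that
  \<open>composition_series_exists\<close> asks for.\<close>

lemma span_rank_strict_mono:
  assumes "submodule K R M" "submodule L R M" "K \<subset> L" "set bs \<subseteq> carrier M" "carrier M \<subseteq> list_span bs"
  shows "span_rank bs K < span_rank bs L"
proof (rule ccontr)
  assume "\<not> ?thesis"
  then have "span_rank bs K = span_rank bs L" using span_rank_mono[of K L bs] assms(3) by auto
  then have "L \<inter> list_span bs \<subseteq> K" using span_rank_eq_imp_subset assms by blast
  then show False using submodule_subset[OF assms(2)] assms(3,5) by blast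
qed

end

section \<open>Tensor products\<close>

text \<open>Closure conditions place the relations inside the free group and give the calculus of
  pure tensors for both kinds of induced module. The laws of the left action are added in
  \<open>tensor_left_module\<close>, for the projective side.\<close>

locale tensor_pair =
  fixes R :: "'r ring" and ract :: "'m \<Rightarrow> 'r \<Rightarrow> 'm"
    and M :: "('a, 'm) module" and N :: "('r, 'n) module"
  assumes add_closed_M: "\<lbrakk>m \<in> carrier M; m' \<in> carrier M\<rbrakk> \<Longrightarrow> m \<oplus>\<^bsub>M\<^esub> m' \<in> carrier M"
    and add_closed_N: "\<lbrakk>n \<in> carrier N; n' \<in> carrier N\<rbrakk> \<Longrightarrow> n \<oplus>\<^bsub>N\<^esub> n' \<in> carrier N"
    and ract_closed: "\<lbrakk>m \<in> carrier M; s \<in> carrier R\<rbrakk> \<Longrightarrow> ract m s \<in> carrier M"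
    and smult_closed_N: "\<lbrakk>s \<in> carrier R; n \<in> carrier N\<rbrakk> \<Longrightarrow> s \<odot>\<^bsub>N\<^esub> n \<in> carrier N"
begin

abbreviation free where "free \<equiv> tensor_free M N"
definition rels where "rels = generate (add_monoid free) (tensor_relations R ract M N)"
abbreviation tensor where "tensor \<equiv> tensor_module R ract M N"
abbreviation pure where "pure m n \<equiv> rels +>\<^bsub>free\<^esub> frag_of (m, n)"

lemma tensor_eq: "tensor = quot_module free rels"
  by (simp add: tensor_module_def rels_def)

lemma carrier_free: "carrier free = {z. Poly_Mapping.keys z \<subseteq> carrier M \<times> carrier N}"
  by (auto simp: tensor_free_def)

lemma add_free [simp]: "x \<oplus>\<^bsub>free\<^esub> y = x + y"
  by (simp add: tensor_free_def)

lemma zero_free [simp]: "\<zero>\<^bsub>free\<^esub> = 0"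
  by (simp add: tensor_free_def)

lemma smult_frag_of: "a \<odot>\<^bsub>free\<^esub> frag_of (m, n) = frag_of (a \<odot>\<^bsub>M\<^esub> m, n)"
  by (simp add: tensor_free_def)

lemma frag_of_free: "m \<in> carrier M \<Longrightarrow> n \<in> carrier N \<Longrightarrow> frag_of (m, n) \<in> carrier free"
  by (simp add: carrier_free)

lemma free_add_closed: "x \<in> carrier free \<Longrightarrow> y \<in> carrier free \<Longrightarrow> x + y \<in> carrier free"
  using keys_add[of x y] by (auto simp: carrier_free)

lemma free_diff_closed: "x \<in> carrier free \<Longrightarrow> y \<in> carrier free \<Longrightarrow> x - y \<in> carrier free"
  using keys_diff[of x y] by (auto simp: carrier_free)

lemma abelian_group_free: "abelian_group free"
proof (rule abelian_groupI)
  show "\<exists>y\<in>carrier free. y \<oplus>\<^bsub>free\<^esub> x = \<zero>\<^bsub>free\<^esub>" if "x \<in> carrier free" for x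
    using that by (intro bexI[of _ "- x"]) (auto simp: carrier_free)
qed (simp_all add: free_add_closed add.assoc add.commute, simp add: carrier_free)

lemma tensor_relations_subset: "tensor_relations R ract M N \<subseteq> carrier free"
  by (auto simp: tensor_relations_def frag_of_free add_closed_M add_closed_N ract_closed smult_closed_N
      intro!: free_diff_closed)

lemma subgroup_rels: "subgroup rels (add_monoid free)"
  using group.generate_is_subgroup[OF abelian_group.a_group[OF abelian_group_free]]
    tensor_relations_subset by (simp add: rels_def)

sublocale free: abelian_subgroup rels free
  by (intro abelian_subgroupI3 additive_subgroupI subgroup_rels abelian_group_free)

lemma a_inv_free: "x \<in> carrier free \<Longrightarrow> \<ominus>\<^bsub>free\<^esub> x = - x"
  by (rule free.minus_equality) (auto simp: carrier_free)

lemma rels_subset: "x \<in> rels \<Longrightarrow> x \<in> carrier free"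
  using free.a_subset by blast

lemma rels_zero: "0 \<in> rels"
  using additive_subgroup.zero_closed[OF free.is_additive_subgroup] by simp

lemma rels_add: "x \<in> rels \<Longrightarrow> y \<in> rels \<Longrightarrow> x + y \<in> rels"
  using additive_subgroup.a_closed[OF free.is_additive_subgroup, of x y] by simp

lemma rels_uminus: "x \<in> rels \<Longrightarrow> - x \<in> rels"
  using additive_subgroup.a_inv_closed[OF free.is_additive_subgroup, of x] rels_subset by (simp add: a_inv_free)

lemma rels_diff: "x \<in> rels \<Longrightarrow> y \<in> rels \<Longrightarrow> x - y \<in> rels"
  using rels_add[of x "- y"] rels_uminus by simp

lemma rels_left:
  "\<lbrakk>m \<in> carrier M; m' \<in> carrier M; n \<in> carrier N\<rbrakk> \<Longrightarrow>
    frag_of (m \<oplus>\<^bsub>M\<^esub> m', n) - frag_of (m, n) - frag_of (m', n) \<in> rels"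
  unfolding rels_def by (rule generate.incl) (auto simp: tensor_relations_def)

lemma rels_right:
  "\<lbrakk>m \<in> carrier M; n \<in> carrier N; n' \<in> carrier N\<rbrakk> \<Longrightarrow>
    frag_of (m, n \<oplus>\<^bsub>N\<^esub> n') - frag_of (m, n) - frag_of (m, n') \<in> rels"
  unfolding rels_def by (rule generate.incl) (auto simp: tensor_relations_def)

lemma rels_balanced:
  "\<lbrakk>m \<in> carrier M; s \<in> carrier R; n \<in> carrier N\<rbrakk> \<Longrightarrow>
    frag_of (ract m s, n) - frag_of (m, s \<odot>\<^bsub>N\<^esub> n) \<in> rels"
  unfolding rels_def by (rule generate.incl) (auto simp: tensor_relations_def)

lemma coset_eq_rels: "x \<in> carrier free \<Longrightarrow> rels +>\<^bsub>free\<^esub> x = rels \<longleftrightarrow> x \<in> rels"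
  using free.a_coset_join1[OF _ _ subgroup_rels] free.a_coset_join2[OF _ subgroup_rels] by blast

lemma coset_eqI: "x \<in> carrier free \<Longrightarrow> y \<in> carrier free \<Longrightarrow> x - y \<in> rels \<Longrightarrow>
    rels +>\<^bsub>free\<^esub> x = rels +>\<^bsub>free\<^esub> y"
  using free.a_coset_add_inv1[of rels x y] free.a_subset coset_eq_rels[of "x - y"]
  by (simp add: a_inv_free free_diff_closed)

lemma coset_add: "x \<in> carrier free \<Longrightarrow> y \<in> carrier free \<Longrightarrow>
    (rels +>\<^bsub>free\<^esub> x) \<oplus>\<^bsub>tensor\<^esub> (rels +>\<^bsub>free\<^esub> y) = rels +>\<^bsub>free\<^esub> (x + y)"
  using free.a_rcos_sum by (simp add: tensor_eq quot_module_def)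

lemma pure_add_left:
  assumes "m \<in> carrier M" "m' \<in> carrier M" "n \<in> carrier N"
  shows "pure (m \<oplus>\<^bsub>M\<^esub> m') n = pure m n \<oplus>\<^bsub>tensor\<^esub> pure m' n"
proof -
  have "pure (m \<oplus>\<^bsub>M\<^esub> m') n = rels +>\<^bsub>free\<^esub> (frag_of (m, n) + frag_of (m', n))"
    using assms rels_left[OF assms]
    by (intro coset_eqI) (simp_all add: frag_of_free add_closed_M free_add_closed diff_diff_eq)
  then show ?thesis using assms by (simp add: coset_add frag_of_free)
qed

lemma pure_add_right:
  assumes "m \<in> carrier M" "n \<in> carrier N" "n' \<in> carrier N"
  shows "pure m (n \<oplus>\<^bsub>N\<^esub> n') = pure m n \<oplus>\<^bsub>tensor\<^esub> pure m n'"
proof -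
  have "pure m (n \<oplus>\<^bsub>N\<^esub> n') = rels +>\<^bsub>free\<^esub> (frag_of (m, n) + frag_of (m, n'))"
    using assms rels_right[OF assms]
    by (intro coset_eqI) (simp_all add: frag_of_free add_closed_N free_add_closed diff_diff_eq)
  then show ?thesis using assms by (simp add: coset_add frag_of_free)
qed

lemma pure_balanced:
  assumes "m \<in> carrier M" "s \<in> carrier R" "n \<in> carrier N"
  shows "pure (ract m s) n = pure m (s \<odot>\<^bsub>N\<^esub> n)"
  using rels_balanced[OF assms] assms
  by (intro coset_eqI) (simp_all add: frag_of_free ract_closed smult_closed_N)

lemma carrier_tensor: "carrier tensor = (\<lambda>z. rels +>\<^bsub>free\<^esub> z) ` carrier free"
  by (auto simp: tensor_eq quot_module_def A_RCOSETS_def')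

lemma zero_tensor: "\<zero>\<^bsub>tensor\<^esub> = rels"
  by (simp add: tensor_eq quot_module_def)

lemma pure_carrier: "m \<in> carrier M \<Longrightarrow> n \<in> carrier N \<Longrightarrow> pure m n \<in> carrier tensor"
  by (auto simp: carrier_tensor frag_of_free)

text \<open>The generators \<open>frag_of (m, n)\<close> produce the whole free group by
  differences, and \<open>rels\<close> is closed under these.\<close>

lemma tensor_trivialI:
  assumes "\<And>m n. m \<in> carrier M \<Longrightarrow> n \<in> carrier N \<Longrightarrow> pure m n = rels"
  shows "carrier tensor = {\<zero>\<^bsub>tensor\<^esub>}"
proof -
  have "z \<in> rels" if "z \<in> carrier free" for z
  proof (rule free_Abelian_group_induct[of z "carrier M \<times> carrier N"])
    show "frag_of a \<in> rels" if "a \<in> carrier M \<times> carrier N" for a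
      using that assms coset_eq_rels frag_of_free by auto
  qed (use that in \<open>auto simp: carrier_free rels_zero rels_diff\<close>)
  then have "(\<lambda>z. rels +>\<^bsub>free\<^esub> z) ` carrier free = (\<lambda>z. rels) ` carrier free"
    by (intro image_cong) (simp_all add: coset_eq_rels)
  moreover have "carrier free \<noteq> {}" using rels_zero rels_subset by blast
  ultimately show ?thesis by (simp add: carrier_tensor zero_tensor image_constant_conv)
qed

text \<open>Neither a well-defined action nor a module structure is needed here: as \<open>0 \<in> rels\<close>, the set
  \<open>rels + a (rels + x)\<close> contains \<open>a x\<close>, and it is a coset by assumption.\<close>

lemma smult_pure_if_carrier:
  assumes "m \<in> carrier M" "n \<in> carrier N" "a \<odot>\<^bsub>M\<^esub> m \<in> carrier M"
    and "a \<odot>\<^bsub>tensor\<^esub> pure m n \<in> carrier tensor"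
  shows "a \<odot>\<^bsub>tensor\<^esub> pure m n = pure (a \<odot>\<^bsub>M\<^esub> m) n"
proof -
  have "frag_of (m, n) \<in> pure m n" using assms free.a_rcos_self frag_of_free by blast
  then have "frag_of (a \<odot>\<^bsub>M\<^esub> m, n) \<in> a \<odot>\<^bsub>tensor\<^esub> pure m n"
  proof -
    assume "frag_of (m, n) \<in> pure m n"
    then have "0 \<oplus>\<^bsub>free\<^esub> a \<odot>\<^bsub>free\<^esub> frag_of (m, n) \<in> rels <+>\<^bsub>free\<^esub> (\<lambda>x. a \<odot>\<^bsub>free\<^esub> x) ` pure m n"
      unfolding set_add_def' using rels_zero by blast
    then show ?thesis by (simp add: tensor_eq quot_module_def smult_frag_of)
  qed
  moreover obtain z where "z \<in> carrier free" "a \<odot>\<^bsub>tensor\<^esub> pure m n = rels +>\<^bsub>free\<^esub> z"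
    using assms(4) by (auto simp: carrier_tensor)
  ultimately have "pure (a \<odot>\<^bsub>M\<^esub> m) n = rels +>\<^bsub>free\<^esub> z" "a \<odot>\<^bsub>tensor\<^esub> pure m n = rels +>\<^bsub>free\<^esub> z"
    using free.a_repr_independence[OF _ _ subgroup_rels, of "frag_of (a \<odot>\<^bsub>M\<^esub> m, n)" z] by simp_all
  then show ?thesis by simp
qed

text \<open>For an idempotent \<open>m\<close> the additivity relation collapses to minus the
  generator. Idempotency replaces \<open>m = \<zero>\<close> because nothing in the locale ties the
  zero of \<open>M\<close> to its addition.\<close>

lemma pure_idem_left:
  assumes "m \<in> carrier M" "n \<in> carrier N" "m \<oplus>\<^bsub>M\<^esub> m = m"
  shows "pure m n = rels"
  using rels_left[of m m n] rels_uminus[of "- frag_of (m, n)"] assms coset_eq_rels[OF frag_of_free]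
  by simp

lemma pure_idem_right:
  assumes "m \<in> carrier M" "n \<in> carrier N" "n \<oplus>\<^bsub>N\<^esub> n = n"
  shows "pure m n = rels"
  using rels_right[of m n n] rels_uminus[of "- frag_of (m, n)"] assms coset_eq_rels[OF frag_of_free]
  by simp

text \<open>Used to see that an isomorphism \<open>h\<close> into the tensor product sends zero to
  \<open>rels\<close>, as the image of zero is idempotent. The cancellation is carried out on
  representatives in the free group.\<close>

lemma coset_idem:
  assumes "x \<in> carrier tensor" "x \<oplus>\<^bsub>tensor\<^esub> x = x"
  shows "x = rels"
proof -
  obtain z where z: "z \<in> carrier free" "x = rels +>\<^bsub>free\<^esub> z" using assms(1) by (auto simp: carrier_tensor)
  then have "rels +>\<^bsub>free\<^esub> (z + z) = rels +>\<^bsub>free\<^esub> z" using assms(2) by (simp add: coset_add)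
  then have "rels +>\<^bsub>free\<^esub> z = rels"
    using free.a_coset_add_inv2[of rels "z + z" z] free.a_subset z(1)
    by (simp add: free_add_closed a_inv_free)
  then show ?thesis using z(2) by simp
qed

text \<open>Closure of the action and \<open>a 0 = 0\<close> on the tensor side are read off from
  \<open>C\<close> through \<open>h\<close>; closure is what \<open>smult_pure_if_carrier\<close>
  asks for. Then \<open>d \<otimes> n = (E d) \<otimes> n = E (d \<otimes> n) = 0\<close>, and
  multiplying by elements of \<open>A\<close> spreads this to all pure tensors.\<close>

lemma trivial_if_annihilated:
  assumes C: "left_module A C" and h: "h \<in> iso (add_monoid C) (add_monoid tensor)"
    and hom: "\<And>a x. a \<in> carrier A \<Longrightarrow> x \<in> carrier C \<Longrightarrow> h (a \<odot>\<^bsub>C\<^esub> x) = a \<odot>\<^bsub>tensor\<^esub> h x"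
    and E: "E \<in> carrier A" "\<And>x. x \<in> carrier C \<Longrightarrow> E \<odot>\<^bsub>C\<^esub> x = \<zero>\<^bsub>C\<^esub>"
    and d: "d \<in> carrier M" "E \<odot>\<^bsub>M\<^esub> d = d"
    and gen: "\<And>m. m \<in> carrier M \<Longrightarrow> \<exists>a\<in>carrier A. a \<odot>\<^bsub>M\<^esub> d = m"
  shows "carrier C = {\<zero>\<^bsub>C\<^esub>}"
proof -
  interpret C: left_module A C by fact
  have bij: "bij_betw h (carrier C) (carrier tensor)"
    and add: "\<And>x y. x \<in> carrier C \<Longrightarrow> y \<in> carrier C \<Longrightarrow> h (x \<oplus>\<^bsub>C\<^esub> y) = h x \<oplus>\<^bsub>tensor\<^esub> h y"
    using h by (auto simp: iso_def hom_def)
  have h0: "h \<zero>\<^bsub>C\<^esub> = rels"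
    using add[of "\<zero>\<^bsub>C\<^esub>" "\<zero>\<^bsub>C\<^esub>"] bij by (intro coset_idem) (auto simp: bij_betw_def)
  have smult_carrier: "a \<odot>\<^bsub>tensor\<^esub> x \<in> carrier tensor" 
    if a: "a \<in> carrier A" and x: "x \<in> carrier tensor" for a x
  proof -
    obtain c where "c \<in> carrier C" "x = h c" using x bij by (auto simp: bij_betw_def)
    then show ?thesis using a hom[of a c] C.smult_closed[of a c] bij by (auto simp: bij_betw_def)
  qed
  have smult_zero: "a \<odot>\<^bsub>tensor\<^esub> rels = rels" if "a \<in> carrier A" for a
    using hom[OF that C.M.zero_closed] C.smult_r_zero[OF that] by (simp add: h0)
  have d_zero: "pure d n = rels" if n: "n \<in> carrier N" for n
  proof -
    obtain c where c: "c \<in> carrier C" "pure d n = h c"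
      using pure_carrier[OF d(1) n] bij by (auto simp: bij_betw_def)
    have "pure d n = E \<odot>\<^bsub>tensor\<^esub> pure d n"
      using smult_pure_if_carrier[OF d(1) n, of E] smult_carrier[OF E(1) pure_carrier[OF d(1) n]] d by simp
    also have "\<dots> = rels" using hom[OF E(1) c(1)] h0 unfolding E(2)[OF c(1)] c(2) by simp
    finally show ?thesis .
  qed
  have "pure m n = rels" if m: "m \<in> carrier M" and n: "n \<in> carrier N" for m n
  proof -
    obtain a where a: "a \<in> carrier A" "a \<odot>\<^bsub>M\<^esub> d = m" using gen[OF m] by blast
    have "pure m n = a \<odot>\<^bsub>tensor\<^esub> pure d n"
      using smult_pure_if_carrier[OF d(1) n, of a] smult_carrier[OF a(1) pure_carrier[OF d(1) n]] a m by simp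
    then show ?thesis using d_zero[OF n] smult_zero[OF a(1)] by simp
  qed
  then have "carrier tensor = {\<zero>\<^bsub>tensor\<^esub>}" by (rule tensor_trivialI)
  then have "h ` carrier C = {rels}" using bij by (simp add: bij_betw_def zero_tensor)
  then have "x = \<zero>\<^bsub>C\<^esub>" if "x \<in> carrier C" for x
    using inj_onD[OF bij_betw_imp_inj_on[OF bij], of x "\<zero>\<^bsub>C\<^esub>"] that h0 by auto
  then show ?thesis by auto
qed

end

section \<open>The left module structure on a tensor product\<close>

locale tensor_left_module = tensor_pair R ract M N + left_module A M
  for A :: "'a ring" and R :: "'r ring" and ract :: "'m \<Rightarrow> 'r \<Rightarrow> 'm"
    and M :: "('a, 'm) module" and N :: "('r, 'n) module" +
  assumes ract_commute: "\<lbrakk>a \<in> carrier A; s \<in> carrier R; m \<in> carrier M\<rbrakk> \<Longrightarrow>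
      a \<odot>\<^bsub>M\<^esub> ract m s = ract (a \<odot>\<^bsub>M\<^esub> m) s"
begin

lemma smult_free_add: "a \<odot>\<^bsub>free\<^esub> (x + y) = a \<odot>\<^bsub>free\<^esub> x + a \<odot>\<^bsub>free\<^esub> y"
  by (simp add: tensor_free_def frag_extend_add)

lemma smult_free_diff: "a \<odot>\<^bsub>free\<^esub> (x - y) = a \<odot>\<^bsub>free\<^esub> x - a \<odot>\<^bsub>free\<^esub> y"
  by (simp add: tensor_free_def frag_extend_diff)

lemma smult_free_zero: "a \<odot>\<^bsub>free\<^esub> 0 = 0"
  by (simp add: tensor_free_def)

lemma free_induct [consumes 1, case_names zero diff pure]:
  assumes "z \<in> carrier free" "P 0"
    and "\<And>x y. \<lbrakk>x \<in> carrier free; y \<in> carrier free; P x; P y\<rbrakk> \<Longrightarrow> P (x - y)"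
    and "\<And>m n. m \<in> carrier M \<Longrightarrow> n \<in> carrier N \<Longrightarrow> P (frag_of (m, n))"
  shows "P z"
  by (rule free_Abelian_group_induct[of z "carrier M \<times> carrier N"]) (use assms in \<open>auto simp: carrier_free\<close>)

lemma smult_free_closed:
  assumes "a \<in> carrier A" "z \<in> carrier free"
  shows "a \<odot>\<^bsub>free\<^esub> z \<in> carrier free"
  using assms(2)
  by (induction z rule: free_induct)
    (simp_all add: smult_free_zero smult_free_diff free_diff_closed smult_frag_of frag_of_free
      smult_closed assms(1), simp add: carrier_free)

text \<open>Each kind of generating relation is sent to one of the same kind; for the balancing
  relation this is \<open>ract_commute\<close>.\<close>

lemma smult_rels:
  assumes a: "a \<in> carrier A" and z: "z \<in> rels"
  shows "a \<odot>\<^bsub>free\<^esub> z \<in> rels"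
proof -
  have rel: "a \<odot>\<^bsub>free\<^esub> z \<in> rels" if "z \<in> tensor_relations R ract M N" for z
    using that a
    by (auto simp: tensor_relations_def smult_free_diff smult_frag_of smult_r_distr ract_commute
        smult_closed intro!: rels_left rels_right rels_balanced)
  show ?thesis
    using z[unfolded rels_def]
  proof (induction z rule: generate.induct)
    case (inv h)
    then have "inv\<^bsub>add_monoid free\<^esub> h = - h"
      using tensor_relations_subset a_inv_free[of h] by (auto simp: a_inv_def)
    then show ?case
      using rels_uminus[OF rel[OF inv]] smult_free_diff[of a 0 h] by (simp add: smult_free_zero)
  qed (use rel in \<open>simp_all add: smult_free_zero rels_zero smult_free_add rels_add\<close>)
qed

sublocale stable: stable_subgroup A rels free
  by unfold_locales (simp_all add: smult_free_closed smult_rels smult_free_add)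

lemma left_module_tensor: "left_module A (tensor_module R ract M N)"
  unfolding tensor_eq
proof (rule stable.left_module_quot)
  fix a b z assume ab: "a \<in> carrier A" "b \<in> carrier A" and z: "z \<in> carrier free"
  \<comment> \<open>In the free group the two sides involve different generators; on a pure tensor
    they differ exactly by an additivity relation in the left factor.\<close>
  have "(a \<oplus>\<^bsub>A\<^esub> b) \<odot>\<^bsub>free\<^esub> z - (a \<odot>\<^bsub>free\<^esub> z + b \<odot>\<^bsub>free\<^esub> z) \<in> rels"
    using z
  proof (induction z rule: free_induct)
    case (diff x y)
    then show ?case using rels_diff[OF diff(3,4)] by (simp add: smult_free_diff algebra_simps)
  next
    case (pure m n)
    then show ?case
      using ab rels_left[of "a \<odot>\<^bsub>M\<^esub> m" "b \<odot>\<^bsub>M\<^esub> m" n]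
      by (simp add: smult_frag_of smult_l_distr smult_closed diff_diff_eq)
  qed (simp add: smult_free_zero rels_zero)
  then show "rels +>\<^bsub>free\<^esub> ((a \<oplus>\<^bsub>A\<^esub> b) \<odot>\<^bsub>free\<^esub> z) = rels +>\<^bsub>free\<^esub> (a \<odot>\<^bsub>free\<^esub> z \<oplus>\<^bsub>free\<^esub> b \<odot>\<^bsub>free\<^esub> z)"
    using ab z by (intro coset_eqI) (simp_all add: smult_free_closed free_add_closed)
  have "(a \<otimes>\<^bsub>A\<^esub> b) \<odot>\<^bsub>free\<^esub> z = a \<odot>\<^bsub>free\<^esub> (b \<odot>\<^bsub>free\<^esub> z)"
    using z by (induction z rule: free_induct)
      (use ab in \<open>simp_all add: smult_free_zero smult_free_diff smult_frag_of smult_assoc\<close>)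
  then show "rels +>\<^bsub>free\<^esub> ((a \<otimes>\<^bsub>A\<^esub> b) \<odot>\<^bsub>free\<^esub> z) = rels +>\<^bsub>free\<^esub> (a \<odot>\<^bsub>free\<^esub> (b \<odot>\<^bsub>free\<^esub> z))"
    by simp
next
  fix z assume "z \<in> carrier free"
  then have "\<one>\<^bsub>A\<^esub> \<odot>\<^bsub>free\<^esub> z = z"
    by (induction z rule: free_induct)
      (simp_all add: smult_free_zero smult_free_diff smult_frag_of smult_one)
  then show "rels +>\<^bsub>free\<^esub> (\<one>\<^bsub>A\<^esub> \<odot>\<^bsub>free\<^esub> z) = rels +>\<^bsub>free\<^esub> z" by simp
qed (rule R.ring_axioms)

lemma smult_pure:
  assumes "a \<in> carrier A" "m \<in> carrier M" "n \<in> carrier N"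
  shows "a \<odot>\<^bsub>tensor\<^esub> pure m n = pure (a \<odot>\<^bsub>M\<^esub> m) n"
  using stable.smult_quot[of a "frag_of (m, n)"] assms
  by (simp add: tensor_eq frag_of_free smult_frag_of)

lemma tensor_induct [consumes 1, case_names zero add uminus pure]:
  assumes "x \<in> carrier tensor"
    and zero: "P \<zero>\<^bsub>tensor\<^esub>"
    and add: "\<And>x y. P x \<Longrightarrow> P y \<Longrightarrow> P (x \<oplus>\<^bsub>tensor\<^esub> y)"
    and uminus: "\<And>x. x \<in> carrier tensor \<Longrightarrow> P x \<Longrightarrow> P (\<ominus>\<^bsub>tensor\<^esub> x)"
    and pure: "\<And>m n. m \<in> carrier M \<Longrightarrow> n \<in> carrier N \<Longrightarrow> P (pure m n)"
  shows "P x"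
proof -
  interpret T: left_module A "tensor_module R ract M N" by (rule left_module_tensor)
  obtain z where z: "z \<in> carrier free" "x = rels +>\<^bsub>free\<^esub> z" using assms(1) by (auto simp: carrier_tensor)
  have zero': "rels +>\<^bsub>free\<^esub> 0 = \<zero>\<^bsub>tensor\<^esub>"
    using coset_eq_rels[of 0] rels_zero rels_subset by (simp add: zero_tensor)
  have "P (rels +>\<^bsub>free\<^esub> z)"
    using z(1)
  proof (induction z rule: free_induct)
    case zero
    then show ?case using zero' \<open>P \<zero>\<^bsub>tensor\<^esub>\<close> by simp
  next
    case (diff x y)
    then have y: "rels +>\<^bsub>free\<^esub> y \<in> carrier tensor"
      and y': "rels +>\<^bsub>free\<^esub> (- y) \<in> carrier tensor"
      and ym: "- y \<in> carrier free" by (auto simp: carrier_tensor carrier_free)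
    have "\<ominus>\<^bsub>tensor\<^esub> (rels +>\<^bsub>free\<^esub> y) = rels +>\<^bsub>free\<^esub> (- y)"
      using diff y y' ym by (intro T.M.minus_equality) (simp_all add: coset_add zero')
    then show ?case
      using add[OF diff(3) uminus[OF y diff(4)]] diff ym by (simp add: coset_add)
  qed (rule pure)
  then show ?thesis using z by simp
qed

end

section \<open>Linearized actions\<close>

text \<open>Provides spans and span induction. Its zero and sum are the overloaded pointwise ones,
  while the module records spell out lambda terms, hence the later rewriting with
  \<open>plus_fun_def\<close> and \<open>zero_fun_def\<close>.\<close>

interpretation fun_space: vector_space "\<lambda>(c :: complex) (f :: 'x \<Rightarrow> complex) x. c * f x"
  by unfold_locales (auto simp: fun_eq_iff algebra_simps)

definition basis_fun :: "'x \<Rightarrow> 'x \<Rightarrow> complex" where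
  "basis_fun x = (\<lambda>y. if y = x then 1 else 0)"

lemma basis_fun_expansion:
  assumes "finite X" "\<And>x. x \<notin> X \<Longrightarrow> v x = 0"
  shows "v = (\<lambda>y. \<Sum>x\<in>X. v x * basis_fun x y)"
  using assms by (auto simp: fun_eq_iff basis_fun_def if_distrib cong: if_cong)

lemma in_span_basis_fun:
  assumes "finite X" "\<And>x. x \<notin> X \<Longrightarrow> v x = 0"
  shows "v \<in> fun_space.span (basis_fun ` X)"
proof -
  have "(\<Sum>x\<in>X. (\<lambda>y. v x * basis_fun x y)) \<in> fun_space.span (basis_fun ` X)"
    by (intro fun_space.span_sum fun_space.span_scale fun_space.span_base) auto
  also have "(\<Sum>x\<in>X. (\<lambda>y. v x * basis_fun x y)) = v"
  proof (rule ext)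
    fix y
    have "(\<Sum>x\<in>X. (\<lambda>y. v x * basis_fun x y)) y = (\<Sum>x\<in>X. v x * basis_fun x y)"
      using assms(1) by (induction X rule: finite_induct) auto
    then show "(\<Sum>x\<in>X. (\<lambda>y. v x * basis_fun x y)) y = v y"
      using fun_cong[OF basis_fun_expansion[of X v], of y] assms by simp
  qed
  finally show ?thesis .
qed

text \<open>Iterated sums with a conditional summand let the order of summation be exchanged
  freely.\<close>

lemma lin_act_eq:
  assumes "finite (carrier S)" "finite X"
  shows "lin_act S X act a v y =
    (if y \<in> X then \<Sum>s\<in>carrier S. \<Sum>x\<in>X. if act s x = y then a s * v x else 0 else 0)"
proof -
  have "{(s, x). s \<in> carrier S \<and> x \<in> X \<and> act s x = y} = {p \<in> carrier S \<times> X. act (fst p) (snd p) = y}"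
    by auto
  then have "(\<Sum>(s, x) \<in> {(s, x). s \<in> carrier S \<and> x \<in> X \<and> act s x = y}. a s * v x)
      = (\<Sum>p\<in>carrier S \<times> X. if act (fst p) (snd p) = y then a (fst p) * v (snd p) else 0)"
    using assms by (simp add: split_def sum.inter_filter del: mem_Sigma_iff)
  then show ?thesis by (simp add: lin_act_def sum.cartesian_product split_def)
qed

section \<open>Bilinearity and values on basis elements\<close>

lemma lin_act_outside: "y \<notin> X \<Longrightarrow> lin_act S X act a v y = 0"
  by (simp add: lin_act_def)

lemma lin_act_add_left:
  "lin_act S X act (\<lambda>s. a s + b s) v = (\<lambda>y. lin_act S X act a v y + lin_act S X act b v y)"
  by (auto simp: lin_act_def fun_eq_iff algebra_simps sum.distrib split_def)

lemma lin_act_add_right: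
  "lin_act S X act a (\<lambda>x. v x + w x) = (\<lambda>y. lin_act S X act a v y + lin_act S X act a w y)"
  by (auto simp: lin_act_def fun_eq_iff algebra_simps sum.distrib split_def)

lemma lin_act_sum_left:
  "lin_act S X act (\<lambda>s. \<Sum>i\<in>I. c i * f i s) v = (\<lambda>y. \<Sum>i\<in>I. c i * lin_act S X act (f i) v y)"
proof
  fix y
  show "lin_act S X act (\<lambda>s. \<Sum>i\<in>I. c i * f i s) v y = (\<Sum>i\<in>I. c i * lin_act S X act (f i) v y)"
    unfolding lin_act_def
    by (auto simp: split_def sum_distrib_left sum_distrib_right mult.assoc intro: sum.swap)
qed

lemma lin_act_sum_right:
  "lin_act S X act a (\<lambda>x. \<Sum>i\<in>I. c i * f i x) = (\<lambda>y. \<Sum>i\<in>I. c i * lin_act S X act a (f i) y)"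
proof
  fix y
  show "lin_act S X act a (\<lambda>x. \<Sum>i\<in>I. c i * f i x) y = (\<Sum>i\<in>I. c i * lin_act S X act a (f i) y)"
    unfolding lin_act_def
    by (auto simp: split_def sum_distrib_left mult.left_commute intro: sum.swap)
qed

lemma lin_act_scale_left:
  "lin_act S X act (\<lambda>s. c * f s) v = (\<lambda>y. c * lin_act S X act f v y)"
  using lin_act_sum_left[where I = "{()}" and c = "\<lambda>_. c" and f = "\<lambda>_. f"] by simp

lemma lin_act_scale_right:
  "lin_act S X act a (\<lambda>x. c * f x) = (\<lambda>y. c * lin_act S X act a f y)"
  using lin_act_sum_right[where I = "{()}" and c = "\<lambda>_. c" and f = "\<lambda>_. f"] by simp

lemma lin_act_basis_left:
  assumes "finite (carrier S)" "finite X" "s \<in> carrier S"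
  shows "lin_act S X act (basis_fun s) v y =
    (if y \<in> X then \<Sum>x\<in>X. if act s x = y then v x else 0 else 0)"
proof -
  have "(\<Sum>s'\<in>carrier S. \<Sum>x\<in>X. if act s' x = y then basis_fun s s' * v x else 0)
      = (\<Sum>s'\<in>carrier S. if s' = s then \<Sum>x\<in>X. if act s x = y then v x else 0 else 0)"
    by (intro sum.cong refl) (auto simp: basis_fun_def intro!: sum.neutral cong: if_cong)
  then show ?thesis using assms by (simp add: lin_act_eq)
qed

lemma lin_act_basis_basis:
  assumes "finite (carrier S)" "finite X" "s \<in> carrier S" "x \<in> X"
  shows "lin_act S X act (basis_fun s) (basis_fun x) =
    (if act s x \<in> X then basis_fun (act s x) else (\<lambda>_. 0))"
proof
  fix y
  have "(\<Sum>x'\<in>X. if act s x' = y then basis_fun x x' else 0)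
      = (\<Sum>x'\<in>X. if x' = x then if act s x = y then 1 else 0 else 0)"
    by (intro sum.cong refl) (auto simp: basis_fun_def)
  also have "\<dots> = (if act s x = y then 1 else 0)" using assms by simp
  finally show "lin_act S X act (basis_fun s) (basis_fun x) y =
    (if act s x \<in> X then basis_fun (act s x) else (\<lambda>_. 0)) y"
    unfolding lin_act_basis_left[OF assms(1-3)] by (auto simp: basis_fun_def[of "act s x"])
qed

text \<open>The factor \<open>c\<close> is included because complex scalars are realized as
  multiples of the identity, in the monoid algebra as well as in the group algebra.\<close>

lemma lin_act_identity:
  assumes "finite (carrier S)" "finite X" "e \<in> carrier S" "\<And>x. x \<in> X \<Longrightarrow> act e x = x"
    and "\<And>x. x \<notin> X \<Longrightarrow> v x = 0"
  shows "lin_act S X act (\<lambda>s. c * basis_fun e s) v = (\<lambda>x. c * v x)"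
proof
  fix y
  have "(\<Sum>x\<in>X. if act e x = y then v x else 0) = (\<Sum>x\<in>X. if x = y then v x else 0)"
    by (intro sum.cong refl) (simp add: assms(4))
  then show "lin_act S X act (\<lambda>s. c * basis_fun e s) v y = c * v y"
    using assms(1-3,5) by (auto simp: lin_act_scale_left lin_act_basis_left)
qed

section \<open>Associativity and commutation of linearized actions\<close>

lemma lin_act_lin_act:
  assumes S: "finite (carrier S)" and T: "finite (carrier T)" and X: "finite X"
  shows "lin_act S X act a (lin_act T X act' b v) y =
    (if y \<in> X then \<Sum>s\<in>carrier S. \<Sum>t\<in>carrier T. \<Sum>x\<in>X.
       if act' t x \<in> X \<and> act s (act' t x) = y then a s * b t * v x else 0 else 0)"
proof -
  have "(\<Sum>z\<in>X. if act s z = y then a s * lin_act T X act' b v z else 0)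
      = (\<Sum>t\<in>carrier T. \<Sum>x\<in>X. if act' t x \<in> X \<and> act s (act' t x) = y then a s * b t * v x else 0)" for s
  proof -
    have "(\<Sum>z\<in>X. if act s z = y then a s * lin_act T X act' b v z else 0)
        = (\<Sum>z\<in>X. \<Sum>t\<in>carrier T. \<Sum>x\<in>X.
            if act' t x = z then if act s z = y then a s * b t * v x else 0 else 0)"
      by (intro sum.cong refl)
        (auto simp: lin_act_eq[OF T X] sum_distrib_left mult.assoc if_distrib cong: if_cong intro!: sum.cong)
    also have "\<dots> = (\<Sum>t\<in>carrier T. \<Sum>z\<in>X. \<Sum>x\<in>X.
            if act' t x = z then if act s z = y then a s * b t * v x else 0 else 0)"
      by (rule sum.swap)
    also have "\<dots> = (\<Sum>t\<in>carrier T. \<Sum>x\<in>X. \<Sum>z\<in>X.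
            if act' t x = z then if act s z = y then a s * b t * v x else 0 else 0)"
      by (intro sum.cong refl sum.swap)
    also have "\<dots> = (\<Sum>t\<in>carrier T. \<Sum>x\<in>X.
            if act' t x \<in> X \<and> act s (act' t x) = y then a s * b t * v x else 0)"
      using X by (intro sum.cong refl) simp
    finally show ?thesis .
  qed
  then show ?thesis by (simp add: lin_act_eq[OF S X])
qed

text \<open>Brings the action of a product into the shape of \<open>lin_act_lin_act\<close>, so that
  the two can be compared summand by summand.\<close>

lemma lin_act_mult:
  assumes S: "finite (carrier S)" and X: "finite X"
    and closed: "\<And>s t. s \<in> carrier S \<Longrightarrow> t \<in> carrier S \<Longrightarrow> s \<otimes>\<^bsub>S\<^esub> t \<in> carrier S"
  shows "lin_act S X act (lin_act S (carrier S) (monoid.mult S) a b) v y =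
    (if y \<in> X then \<Sum>s\<in>carrier S. \<Sum>t\<in>carrier S. \<Sum>x\<in>X.
       if act (s \<otimes>\<^bsub>S\<^esub> t) x = y then a s * b t * v x else 0 else 0)"
proof -
  have "(\<Sum>u\<in>carrier S. \<Sum>x\<in>X. if act u x = y then lin_act S (carrier S) (monoid.mult S) a b u * v x else 0)
      = (\<Sum>u\<in>carrier S. \<Sum>x\<in>X. \<Sum>s\<in>carrier S. \<Sum>t\<in>carrier S.
          if s \<otimes>\<^bsub>S\<^esub> t = u then if act u x = y then a s * b t * v x else 0 else 0)"
    by (intro sum.cong refl)
      (auto simp: lin_act_eq[OF S S] sum_distrib_right if_distrib cong: if_cong intro!: sum.cong)
  also have "\<dots> = (\<Sum>x\<in>X. \<Sum>u\<in>carrier S. \<Sum>s\<in>carrier S. \<Sum>t\<in>carrier S.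
          if s \<otimes>\<^bsub>S\<^esub> t = u then if act u x = y then a s * b t * v x else 0 else 0)"
    by (rule sum.swap)
  also have "\<dots> = (\<Sum>x\<in>X. \<Sum>s\<in>carrier S. \<Sum>u\<in>carrier S. \<Sum>t\<in>carrier S.
          if s \<otimes>\<^bsub>S\<^esub> t = u then if act u x = y then a s * b t * v x else 0 else 0)"
    by (intro sum.cong refl sum.swap)
  also have "\<dots> = (\<Sum>x\<in>X. \<Sum>s\<in>carrier S. \<Sum>t\<in>carrier S. \<Sum>u\<in>carrier S.
          if s \<otimes>\<^bsub>S\<^esub> t = u then if act u x = y then a s * b t * v x else 0 else 0)"
    by (intro sum.cong refl sum.swap)
  also have "\<dots> = (\<Sum>x\<in>X. \<Sum>s\<in>carrier S. \<Sum>t\<in>carrier S.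
          if act (s \<otimes>\<^bsub>S\<^esub> t) x = y then a s * b t * v x else 0)"
    using S closed by (intro sum.cong refl) simp
  also have "\<dots> = (\<Sum>s\<in>carrier S. \<Sum>x\<in>X. \<Sum>t\<in>carrier S.
          if act (s \<otimes>\<^bsub>S\<^esub> t) x = y then a s * b t * v x else 0)"
    by (rule sum.swap)
  also have "\<dots> = (\<Sum>s\<in>carrier S. \<Sum>t\<in>carrier S. \<Sum>x\<in>X.
          if act (s \<otimes>\<^bsub>S\<^esub> t) x = y then a s * b t * v x else 0)"
    by (intro sum.cong refl sum.swap)
  finally show ?thesis by (simp add: lin_act_eq[OF S X])
qed

text \<open>The action is cut off to zero outside \<open>X\<close>. By \<open>stay\<close>, a point
  that has left \<open>X\<close> cannot return; a returning one would be counted on the left side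
  but killed halfway on the right side.\<close>

lemma lin_act_assoc:
  assumes "finite (carrier S)" "finite X"
    and "\<And>s t. s \<in> carrier S \<Longrightarrow> t \<in> carrier S \<Longrightarrow> s \<otimes>\<^bsub>S\<^esub> t \<in> carrier S"
    and act: "\<And>s t x. \<lbrakk>s \<in> carrier S; t \<in> carrier S; x \<in> X\<rbrakk> \<Longrightarrow> act (s \<otimes>\<^bsub>S\<^esub> t) x = act s (act t x)"
    and stay: "\<And>s t x. \<lbrakk>s \<in> carrier S; t \<in> carrier S; x \<in> X; act s (act t x) \<in> X\<rbrakk> \<Longrightarrow> act t x \<in> X"
  shows "lin_act S X act (lin_act S (carrier S) (monoid.mult S) a b) v =
    lin_act S X act a (lin_act S X act b v)"
proof
  fix y
  have "(if act (s \<otimes>\<^bsub>S\<^esub> t) x = y then a s * b t * v x else 0)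
      = (if act t x \<in> X \<and> act s (act t x) = y then a s * b t * v x else 0)"
    if "y \<in> X" "s \<in> carrier S" "t \<in> carrier S" "x \<in> X" for s t x
    using act[OF that(2-4)] stay[OF that(2-4)] that(1) by simp
  note pointwise = this
  have "lin_act S X act (lin_act S (carrier S) (monoid.mult S) a b) v y =
    (if y \<in> X then \<Sum>s\<in>carrier S. \<Sum>t\<in>carrier S. \<Sum>x\<in>X.
       if act (s \<otimes>\<^bsub>S\<^esub> t) x = y then a s * b t * v x else 0 else 0)"
    by (rule lin_act_mult) fact+
  also have "\<dots> = lin_act S X act a (lin_act S X act b v) y"
    unfolding lin_act_lin_act[OF assms(1,1,2), of act a act b v y]
    by (intro if_cong[OF refl _ refl] sum.cong refl pointwise)
  finally show "lin_act S X act (lin_act S (carrier S) (monoid.mult S) a b) v y =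
    lin_act S X act a (lin_act S X act b v) y" .
qed

text \<open>Whenever the common end point lies in \<open>X\<close>, so do both intermediate points:
  \<open>act' t x\<close> by \<open>closed\<close> and \<open>act s x\<close> by
  \<open>stay\<close>. Hence neither order loses a summand to the cut-off.\<close>

lemma lin_act_commute:
  assumes "finite (carrier S)" "finite (carrier T)" "finite X"
    and comm: "\<And>s t x. \<lbrakk>s \<in> carrier S; t \<in> carrier T; x \<in> X\<rbrakk> \<Longrightarrow> act s (act' t x) = act' t (act s x)"
    and closed: "\<And>t x. \<lbrakk>t \<in> carrier T; x \<in> X\<rbrakk> \<Longrightarrow> act' t x \<in> X"
    and stay: "\<And>s t x. \<lbrakk>s \<in> carrier S; t \<in> carrier T; x \<in> X; act' t (act s x) \<in> X\<rbrakk> \<Longrightarrow> act s x \<in> X"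
  shows "lin_act S X act a (lin_act T X act' b v) = lin_act T X act' b (lin_act S X act a v)"
proof
  fix y
  have "(if act' t x \<in> X \<and> act s (act' t x) = y then a s * b t * v x else 0)
      = (if act s x \<in> X \<and> act' t (act s x) = y then b t * a s * v x else 0)"
    if "y \<in> X" "s \<in> carrier S" "t \<in> carrier T" "x \<in> X" for s t x
    using comm[OF that(2-4)] closed[OF that(3,4)] stay[OF that(2-4)] that(1)
    by (simp add: mult.commute)
  then show "lin_act S X act a (lin_act T X act' b v) y = lin_act T X act' b (lin_act S X act a v) y"
    unfolding lin_act_lin_act[OF assms(1,2,3), of act a act' b v y]
      lin_act_lin_act[OF assms(2,1,3), of act' b act a v y]
    by (subst (2) sum.swap) (intro if_cong[OF refl _ refl] sum.cong refl)
qed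

section \<open>Monoid algebras and their modules\<close>

lemma monoid_algebra_simps:
  "carrier (monoid_algebra S) = {f. \<forall>x. x \<notin> carrier S \<longrightarrow> f x = 0}"
  "f \<otimes>\<^bsub>monoid_algebra S\<^esub> g = lin_act S (carrier S) (monoid.mult S) f g"
  "\<one>\<^bsub>monoid_algebra S\<^esub> = basis_fun \<one>\<^bsub>S\<^esub>"
  "\<zero>\<^bsub>monoid_algebra S\<^esub> = (\<lambda>_. 0)"
  "f \<oplus>\<^bsub>monoid_algebra S\<^esub> g = (\<lambda>x. f x + g x)"
  by (auto simp: monoid_algebra_def basis_fun_def)

lemma lin_module_simps:
  "carrier (lin_module S X act) = {f. \<forall>x. x \<notin> X \<longrightarrow> f x = 0}"
  "a \<odot>\<^bsub>lin_module S X act\<^esub> v = lin_act S X act a v"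
  "\<zero>\<^bsub>lin_module S X act\<^esub> = (\<lambda>_. 0)"
  "f \<oplus>\<^bsub>lin_module S X act\<^esub> g = (\<lambda>x. f x + g x)"
  by (auto simp: lin_module_def)

lemma abelian_group_functions:
  assumes "carrier M = {f. \<forall>x. x \<notin> X \<longrightarrow> f x = (0 :: complex)}" "\<zero>\<^bsub>M\<^esub> = (\<lambda>_. 0)"
    and "\<And>f g. f \<oplus>\<^bsub>M\<^esub> g = (\<lambda>x. f x + g x)"
  shows "abelian_group M"
proof (rule abelian_groupI)
  fix f assume "f \<in> carrier M"
  then show "\<exists>g\<in>carrier M. g \<oplus>\<^bsub>M\<^esub> f = \<zero>\<^bsub>M\<^esub>" by (intro bexI[of _ "\<lambda>x. - f x"]) (auto simp: assms)
qed (auto simp: assms fun_eq_iff)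

lemma ring_monoid_algebra:
  assumes S: "monoid S" and fin: "finite (carrier S)"
  shows "ring (monoid_algebra S)"
proof -
  interpret S: monoid S by fact
  have unit: "lin_act S (carrier S) (monoid.mult S) f (basis_fun \<one>\<^bsub>S\<^esub>) = f"
    if "\<And>x. x \<notin> carrier S \<Longrightarrow> f x = 0" for f
  proof
    fix y
    have "(\<Sum>s\<in>carrier S. \<Sum>x\<in>carrier S. if s \<otimes>\<^bsub>S\<^esub> x = y then f s * basis_fun \<one>\<^bsub>S\<^esub> x else 0)
      = (\<Sum>s\<in>carrier S. \<Sum>x\<in>carrier S. if x = \<one>\<^bsub>S\<^esub> then if s = y then f s else 0 else 0)"
      by (intro sum.cong refl) (auto simp: basis_fun_def)
    then show "lin_act S (carrier S) (monoid.mult S) f (basis_fun \<one>\<^bsub>S\<^esub>) y = f y"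
      using fin that by (auto simp: lin_act_eq)
  qed
  show ?thesis
  proof (rule ringI)
    show "abelian_group (monoid_algebra S)"
      by (rule abelian_group_functions[of _ "carrier S"]) (auto simp: monoid_algebra_simps)
    show "monoid (monoid_algebra S)"
    proof (rule monoidI)
      fix f g h
      show "f \<otimes>\<^bsub>monoid_algebra S\<^esub> g \<otimes>\<^bsub>monoid_algebra S\<^esub> h = f \<otimes>\<^bsub>monoid_algebra S\<^esub> (g \<otimes>\<^bsub>monoid_algebra S\<^esub> h)"
        unfolding monoid_algebra_simps by (rule lin_act_assoc) (auto simp: fin S.m_assoc)
    next
      fix f assume "f \<in> carrier (monoid_algebra S)"
      then show "\<one>\<^bsub>monoid_algebra S\<^esub> \<otimes>\<^bsub>monoid_algebra S\<^esub> f = f" "f \<otimes>\<^bsub>monoid_algebra S\<^esub> \<one>\<^bsub>monoid_algebra S\<^esub> = f"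
        using lin_act_identity[of S "carrier S" "\<one>\<^bsub>S\<^esub>" "monoid.mult S" f 1] unit[of f] fin
        by (auto simp: monoid_algebra_simps)
    qed (auto simp: monoid_algebra_simps lin_act_outside basis_fun_def)
  qed (simp_all add: monoid_algebra_simps lin_act_add_left lin_act_add_right)
qed

lemma left_module_lin_module:
  assumes S: "monoid S" and fin: "finite (carrier S)" "finite X"
    and one: "\<And>x. x \<in> X \<Longrightarrow> act \<one>\<^bsub>S\<^esub> x = x"
    and act: "\<And>s t x. \<lbrakk>s \<in> carrier S; t \<in> carrier S; x \<in> X\<rbrakk> \<Longrightarrow> act (s \<otimes>\<^bsub>S\<^esub> t) x = act s (act t x)"
    and stay: "\<And>s t x. \<lbrakk>s \<in> carrier S; t \<in> carrier S; x \<in> X; act s (act t x) \<in> X\<rbrakk> \<Longrightarrow> act t x \<in> X"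
  shows "left_module (monoid_algebra S) (lin_module S X act)"
proof -
  interpret S: monoid S by fact
  show ?thesis
  proof (intro left_module.intro left_module_axioms.intro)
    show "ring (monoid_algebra S)" by (rule ring_monoid_algebra) fact+
    show "abelian_group (lin_module S X act)"
      by (rule abelian_group_functions[of _ X]) (auto simp: lin_module_simps)
    show "a \<otimes>\<^bsub>monoid_algebra S\<^esub> b \<odot>\<^bsub>lin_module S X act\<^esub> v
        = a \<odot>\<^bsub>lin_module S X act\<^esub> (b \<odot>\<^bsub>lin_module S X act\<^esub> v)" for a b v
      unfolding monoid_algebra_simps lin_module_simps
      by (rule lin_act_assoc) (fact fin S.m_closed act stay)+
    show "\<one>\<^bsub>monoid_algebra S\<^esub> \<odot>\<^bsub>lin_module S X act\<^esub> v = v" if "v \<in> carrier (lin_module S X act)" for v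
      using that lin_act_identity[of S X "\<one>\<^bsub>S\<^esub>" act v 1] fin one
      by (auto simp: monoid_algebra_simps lin_module_simps)
  qed (auto simp: monoid_algebra_simps lin_module_simps lin_act_outside lin_act_add_left lin_act_add_right)
qed

text \<open>The multiples of the identity form a copy of the complex numbers, which makes
  \<open>span_rank\<close> available for modules over a monoid algebra.\<close>

lemma field_module_monoid_algebra:
  assumes S: "monoid S" and fin: "finite (carrier S)" and M: "left_module (monoid_algebra S) M"
  shows "field_module (monoid_algebra S) M (\<lambda>c s. c * basis_fun \<one>\<^bsub>S\<^esub> s)"
proof (intro field_module.intro field_module_axioms.intro)
  interpret S: monoid S by fact
  show "left_module (monoid_algebra S) M" by fact
  fix c d :: complex
  have one: "basis_fun \<one>\<^bsub>S\<^esub> x = 0" if "x \<notin> carrier S" for x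
    using that S.one_closed unfolding basis_fun_def by metis
  then show "(\<lambda>s. c * basis_fun \<one>\<^bsub>S\<^esub> s) \<in> carrier (monoid_algebra S)"
    by (simp add: monoid_algebra_simps(1))
  show "(\<lambda>s. (c + d) * basis_fun \<one>\<^bsub>S\<^esub> s)
      = (\<lambda>s. c * basis_fun \<one>\<^bsub>S\<^esub> s) \<oplus>\<^bsub>monoid_algebra S\<^esub> (\<lambda>s. d * basis_fun \<one>\<^bsub>S\<^esub> s)"
    by (simp add: monoid_algebra_simps(5) distrib_right)
  have "lin_act S (carrier S) (monoid.mult S) (\<lambda>s. c * basis_fun \<one>\<^bsub>S\<^esub> s) (\<lambda>s. d * basis_fun \<one>\<^bsub>S\<^esub> s)
      = (\<lambda>s. c * (d * basis_fun \<one>\<^bsub>S\<^esub> s))"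
    by (rule lin_act_identity) (simp_all add: fin one)
  then show "(\<lambda>s. c * d * basis_fun \<one>\<^bsub>S\<^esub> s)
      = (\<lambda>s. c * basis_fun \<one>\<^bsub>S\<^esub> s) \<otimes>\<^bsub>monoid_algebra S\<^esub> (\<lambda>s. d * basis_fun \<one>\<^bsub>S\<^esub> s)"
    by (simp only: monoid_algebra_simps(2) mult.assoc)
qed (simp add: monoid_algebra_simps(3))

section \<open>Specht modules\<close>

lemma sum_fun_apply: "(\<Sum>i\<in>I. f i) x = (\<Sum>i\<in>I. f i x)"
  for f :: "'i \<Rightarrow> 'x \<Rightarrow> complex"
  by (induction I rule: infinite_finite_induct) auto

abbreviation (input) perm_act :: "(nat \<Rightarrow> nat) \<Rightarrow> (nat \<Rightarrow> nat set) \<Rightarrow> nat \<Rightarrow> nat set" where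
  "perm_act \<equiv> \<lambda>\<sigma> T i. \<sigma> ` T i"

lemma finite_sym_group: "finite (carrier (sym_group k))"
  by (simp add: sym_group_def finite_permutations)

lemma finite_young_diagram: "finite (young_diagram \<alpha>)"
proof -
  have "young_diagram \<alpha> = Sigma {..<length \<alpha>} (\<lambda>i. {..<\<alpha> ! i})" by (auto simp: young_diagram_def)
  then show ?thesis by simp
qed

lemma tabloid_cong:
  assumes "\<And>p. p \<in> young_diagram \<alpha> \<Longrightarrow> t p = t' p"
  shows "tabloid \<alpha> t = tabloid \<alpha> t'"
  unfolding tabloid_def tableau_row_def using assms by (auto simp: fun_eq_iff) metis+

lemma tableau_column_cong:
  assumes "\<And>p. p \<in> young_diagram \<alpha> \<Longrightarrow> t p = t' p"
  shows "tableau_column \<alpha> t = tableau_column \<alpha> t'"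
  unfolding tableau_column_def using assms by (auto simp: fun_eq_iff) metis+

lemma polytabloid_cong:
  assumes "\<And>p. p \<in> young_diagram \<alpha> \<Longrightarrow> t p = t' p"
  shows "polytabloid \<alpha> t = polytabloid \<alpha> t'"
proof -
  have "tableau_column \<alpha> t = tableau_column \<alpha> t'"
    by (rule tableau_column_cong) (rule assms)
  then have "column_group \<alpha> t = column_group \<alpha> t'"
    by (simp add: column_group_def)
  moreover have "tabloid \<alpha> (\<pi> \<circ> t) = tabloid \<alpha> (\<pi> \<circ> t')" for \<pi>
    by (rule tabloid_cong) (simp add: assms)
  ultimately show ?thesis by (simp add: polytabloid_def)
qed

text \<open>Tableaux carry arbitrary values outside the diagram and are therefore infinite in
  number. What depends only on the values inside factors through the finitely many
  restrictions.\<close>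

lemma finite_image_tableaux:
  assumes "\<And>t t'. (\<And>p. p \<in> young_diagram \<alpha> \<Longrightarrow> t p = t' p) \<Longrightarrow> f t = f t'"
  shows "finite {f t | t. is_tableau \<alpha> t}"
proof (rule finite_subset)
  show "finite (f ` (young_diagram \<alpha> \<rightarrow>\<^sub>E {1..sum_list \<alpha>}))"
    by (intro finite_imageI finite_PiE finite_young_diagram) simp
  show "{f t | t. is_tableau \<alpha> t} \<subseteq> f ` (young_diagram \<alpha> \<rightarrow>\<^sub>E {1..sum_list \<alpha>})"
  proof safe
    fix t assume "is_tableau \<alpha> t"
    then have "restrict t (young_diagram \<alpha>) \<in> young_diagram \<alpha> \<rightarrow>\<^sub>E {1..sum_list \<alpha>}"
      unfolding is_tableau_def bij_betw_def by (simp only: restrict_PiE_iff) blast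
    moreover have "f t = f (restrict t (young_diagram \<alpha>))" by (rule assms) simp
    ultimately show "f t \<in> f ` (young_diagram \<alpha> \<rightarrow>\<^sub>E {1..sum_list \<alpha>})" by blast
  qed
qed

lemma finite_tabloids: "finite (tabloids \<alpha>)"
  unfolding tabloids_def by (rule finite_image_tableaux) (rule tabloid_cong)

lemma finite_polytabloids: "finite (polytabloids \<alpha>)"
  unfolding polytabloids_def by (rule finite_image_tableaux) (rule polytabloid_cong)

lemma is_tableau_comp:
  assumes "is_tableau \<alpha> t" "\<sigma> \<in> carrier (sym_group (sum_list \<alpha>))"
  shows "is_tableau \<alpha> (\<sigma> \<circ> t)"
  using assms bij_betw_trans[OF _ permutes_imp_bij] unfolding is_tableau_def sym_group_carrier
  by blast

lemma perm_act_tabloid: "perm_act \<sigma> (tabloid \<alpha> t) = tabloid \<alpha> (\<sigma> \<circ> t)"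
  by (auto simp: tabloid_def tableau_row_def fun_eq_iff)

lemma image_tableau_column: "\<sigma> ` tableau_column \<alpha> t j = tableau_column \<alpha> (\<sigma> \<circ> t) j"
  by (auto simp: tableau_column_def)

section \<open>Polytabloids under permutations\<close>

lemma polytabloid_eq:
  "polytabloid \<alpha> t = (\<lambda>T. \<Sum>\<pi>\<in>column_group \<alpha> t. of_int (sign \<pi>) * basis_fun (tabloid \<alpha> (\<pi> \<circ> t)) T)"
  by (auto simp: polytabloid_def basis_fun_def fun_eq_iff intro!: sum.cong)

lemma column_group_subset: "\<pi> \<in> column_group \<alpha> t \<Longrightarrow> \<pi> \<in> carrier (sym_group (sum_list \<alpha>))"
  by (simp add: column_group_def)

lemma polytabloid_outside:
  assumes "is_tableau \<alpha> t" "T \<notin> tabloids \<alpha>"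
  shows "polytabloid \<alpha> t T = 0"
  unfolding polytabloid_def
  using assms is_tableau_comp column_group_subset by (intro sum.neutral) (auto simp: tabloids_def)

lemma lin_act_polytabloid_expand:
  assumes t: "is_tableau \<alpha> t" and \<sigma>: "\<sigma> \<in> carrier (sym_group (sum_list \<alpha>))"
  shows "lin_act (sym_group (sum_list \<alpha>)) (tabloids \<alpha>) perm_act (basis_fun \<sigma>) (polytabloid \<alpha> t)
    = (\<lambda>T. \<Sum>\<pi>\<in>column_group \<alpha> t. of_int (sign \<pi>) * basis_fun (tabloid \<alpha> (\<sigma> \<circ> \<pi> \<circ> t)) T)"
proof -
  have "lin_act (sym_group (sum_list \<alpha>)) (tabloids \<alpha>) perm_act (basis_fun \<sigma>)
      (basis_fun (tabloid \<alpha> (\<pi> \<circ> t))) = basis_fun (tabloid \<alpha> (\<sigma> \<circ> \<pi> \<circ> t))"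
    if "\<pi> \<in> column_group \<alpha> t" for \<pi>
  proof -
    have "is_tableau \<alpha> (\<pi> \<circ> t)" using is_tableau_comp[OF t] column_group_subset[OF that] .
    then have "tabloid \<alpha> (\<pi> \<circ> t) \<in> tabloids \<alpha>" "tabloid \<alpha> (\<sigma> \<circ> (\<pi> \<circ> t)) \<in> tabloids \<alpha>"
      using is_tableau_comp[OF _ \<sigma>] by (auto simp: tabloids_def)
    then show ?thesis
      using \<sigma> by (simp add: lin_act_basis_basis finite_sym_group finite_tabloids perm_act_tabloid o_assoc)
  qed
  then show ?thesis
    unfolding polytabloid_eq lin_act_sum_right by (auto simp: fun_eq_iff intro!: sum.cong)
qed

lemma sign_mult: "\<sigma> permutes {1..k :: nat} \<Longrightarrow> \<pi> permutes {1..k} \<Longrightarrow> sign (\<sigma> \<circ> \<pi>) = sign \<sigma> * sign \<pi>"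
  by (intro sign_compose) (auto simp: permutation_permutes)

text \<open>The column group of \<open>\<sigma> \<circ> t\<close> is the conjugate by
  \<open>\<sigma>\<close> of that of \<open>t\<close>, and conjugation preserves signs, so the sum
  can be reindexed.\<close>

lemma lin_act_polytabloid:
  assumes t: "is_tableau \<alpha> t" and \<sigma>: "\<sigma> \<in> carrier (sym_group (sum_list \<alpha>))"
  shows "lin_act (sym_group (sum_list \<alpha>)) (tabloids \<alpha>) perm_act (basis_fun \<sigma>) (polytabloid \<alpha> t)
    = polytabloid \<alpha> (\<sigma> \<circ> t)"
proof
  fix T
  let ?\<tau> = "inv_into UNIV \<sigma>"
  have p: "\<sigma> permutes {1..sum_list \<alpha>}" using \<sigma> by (simp add: sym_group_carrier)
  have q: "?\<tau> permutes {1..sum_list \<alpha>}" using permutes_inv[OF p] .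
  have \<tau>\<sigma>: "?\<tau> \<circ> \<sigma> = id" "\<sigma> \<circ> ?\<tau> = id" using permutes_inv_o[OF p] by auto
  have col: "\<sigma> ` tableau_column \<alpha> t j = tableau_column \<alpha> (\<sigma> \<circ> t) j" for j
    by (rule image_tableau_column)
  have col': "?\<tau> ` tableau_column \<alpha> (\<sigma> \<circ> t) j = tableau_column \<alpha> t j" for j
    using \<tau>\<sigma> by (simp flip: col add: image_comp)
  have sgn: "sign (\<sigma> \<circ> \<pi> \<circ> ?\<tau>) = sign \<pi>" if "\<pi> permutes {1..sum_list \<alpha>}" for \<pi>
    using sign_mult[OF permutes_compose[OF that p] q] sign_mult[OF p that] sign_mult[OF p q] \<tau>\<sigma>(2)
    by (simp add: sign_id mult.assoc mult.commute)
  have "(\<Sum>\<pi>\<in>column_group \<alpha> t. of_int (sign \<pi>) * basis_fun (tabloid \<alpha> (\<sigma> \<circ> \<pi> \<circ> t)) T)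
      = (\<Sum>\<pi>\<in>column_group \<alpha> (\<sigma> \<circ> t). of_int (sign \<pi>) * basis_fun (tabloid \<alpha> (\<pi> \<circ> (\<sigma> \<circ> t))) T)"
  proof (rule sum.reindex_bij_witness[where j = "\<lambda>\<pi>. \<sigma> \<circ> \<pi> \<circ> ?\<tau>" and i = "\<lambda>\<pi>. ?\<tau> \<circ> \<pi> \<circ> \<sigma>"])
    fix \<pi> assume \<pi>: "\<pi> \<in> column_group \<alpha> t"
    then have pp: "\<pi> permutes {1..sum_list \<alpha>}" by (simp add: column_group_def sym_group_carrier)
    show "?\<tau> \<circ> (\<sigma> \<circ> \<pi> \<circ> ?\<tau>) \<circ> \<sigma> = \<pi>" using \<tau>\<sigma> by (metis comp_assoc comp_id id_comp)
    show "\<sigma> \<circ> \<pi> \<circ> ?\<tau> \<in> column_group \<alpha> (\<sigma> \<circ> t)"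
    proof -
      have "\<pi> ` tableau_column \<alpha> t j = tableau_column \<alpha> t j" for j
        using \<pi> by (simp add: column_group_def)
      then have "(\<sigma> \<circ> \<pi> \<circ> ?\<tau>) ` tableau_column \<alpha> (\<sigma> \<circ> t) j = tableau_column \<alpha> (\<sigma> \<circ> t) j" for j
        by (simp only: col col' flip: image_comp)
      then show ?thesis
        using permutes_compose[OF q permutes_compose[OF pp p]]
        by (simp add: column_group_def sym_group_carrier o_assoc)
    qed
    have "\<sigma> \<circ> \<pi> \<circ> ?\<tau> \<circ> (\<sigma> \<circ> t) = \<sigma> \<circ> \<pi> \<circ> t" using \<tau>\<sigma> by (metis comp_assoc id_comp)
    then show "of_int (sign (\<sigma> \<circ> \<pi> \<circ> ?\<tau>)) * basis_fun (tabloid \<alpha> (\<sigma> \<circ> \<pi> \<circ> ?\<tau> \<circ> (\<sigma> \<circ> t))) T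
       = of_int (sign \<pi>) * basis_fun (tabloid \<alpha> (\<sigma> \<circ> \<pi> \<circ> t)) T"
      using sgn[OF pp] by simp
  next
    fix \<pi> assume \<pi>: "\<pi> \<in> column_group \<alpha> (\<sigma> \<circ> t)"
    then have pp: "\<pi> permutes {1..sum_list \<alpha>}" by (simp add: column_group_def sym_group_carrier)
    show "\<sigma> \<circ> (?\<tau> \<circ> \<pi> \<circ> \<sigma>) \<circ> ?\<tau> = \<pi>" using \<tau>\<sigma> by (metis comp_assoc comp_id id_comp)
    show "?\<tau> \<circ> \<pi> \<circ> \<sigma> \<in> column_group \<alpha> t"
    proof -
      have "\<pi> ` tableau_column \<alpha> (\<sigma> \<circ> t) j = tableau_column \<alpha> (\<sigma> \<circ> t) j" for j
        using \<pi> by (simp add: column_group_def)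
      then have "(?\<tau> \<circ> \<pi> \<circ> \<sigma>) ` tableau_column \<alpha> t j = tableau_column \<alpha> t j" for j
        by (simp only: col col' flip: image_comp)
      then show ?thesis
        using permutes_compose[OF p permutes_compose[OF pp q]]
        by (simp add: column_group_def sym_group_carrier o_assoc)
    qed
  qed
  then show "lin_act (sym_group (sum_list \<alpha>)) (tabloids \<alpha>) perm_act (basis_fun \<sigma>) (polytabloid \<alpha> t) T
    = polytabloid \<alpha> (\<sigma> \<circ> t) T"
    unfolding lin_act_polytabloid_expand[OF t \<sigma>] by (simp add: polytabloid_eq)
qed

text \<open>Both entries lie in column \<open>j\<close> and, as \<open>t\<close> is injective, in no
  other one; exchanging them maps every column to itself.\<close>

lemma transpose_in_column_group:
  assumes t: "is_tableau \<alpha> t" and "(i, j) \<in> young_diagram \<alpha>" "(i', j) \<in> young_diagram \<alpha>"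
  shows "transpose (t (i, j)) (t (i', j)) \<in> column_group \<alpha> t"
proof -
  let ?a = "t (i, j)" and ?b = "t (i', j)"
  have inj: "inj_on t (young_diagram \<alpha>)" and im: "t ` young_diagram \<alpha> = {1..sum_list \<alpha>}"
    using t by (auto simp: is_tableau_def bij_betw_def)
  have "?a \<in> {1..sum_list \<alpha>}" "?b \<in> {1..sum_list \<alpha>}" using im assms(2,3) by blast+
  then have "transpose ?a ?b permutes {1..sum_list \<alpha>}" by (rule permutes_swap_id)
  moreover have "transpose ?a ?b ` tableau_column \<alpha> t l = tableau_column \<alpha> t l" for l
  proof (cases "l = j")
    case True
    then have "?a \<in> tableau_column \<alpha> t l" "?b \<in> tableau_column \<alpha> t l"
      using assms(2,3) by (auto simp: tableau_column_def)
    then show ?thesis by simp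
  next
    case False
    then have "?a \<notin> tableau_column \<alpha> t l" "?b \<notin> tableau_column \<alpha> t l"
      using inj_onD[OF inj] assms(2,3) by (auto simp: tableau_column_def)
    then show ?thesis by simp
  qed
  ultimately show ?thesis by (simp add: column_group_def sym_group_carrier)
qed

text \<open>Left multiplication by the transposition permutes the column group and reverses signs.
  It is an involution, so one map serves both directions of the reindexing.\<close>

lemma lin_act_transpose_polytabloid:
  assumes t: "is_tableau \<alpha> t" and "(i, j) \<in> young_diagram \<alpha>" "(i', j) \<in> young_diagram \<alpha>" "i \<noteq> i'"
  shows "lin_act (sym_group (sum_list \<alpha>)) (tabloids \<alpha>) perm_act
      (basis_fun (transpose (t (i, j)) (t (i', j)))) (polytabloid \<alpha> t)
    = (\<lambda>T. - polytabloid \<alpha> t T)"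
proof
  fix T
  let ?\<tau> = "transpose (t (i, j)) (t (i', j))"
  have \<tau>: "?\<tau> \<in> column_group \<alpha> t" by (rule transpose_in_column_group) fact+
  then have \<tau>S: "?\<tau> \<in> carrier (sym_group (sum_list \<alpha>))" by (rule column_group_subset)
  have "t (i, j) \<noteq> t (i', j)"
    using t assms(2-4) by (auto simp: is_tableau_def bij_betw_def dest: inj_onD)
  then have sgn: "sign (?\<tau> \<circ> \<pi>) = - sign \<pi>" if "\<pi> \<in> column_group \<alpha> t" for \<pi>
    using sign_mult[of ?\<tau> "sum_list \<alpha>" \<pi>] \<tau>S column_group_subset[OF that]
    by (simp add: sym_group_carrier sign_swap_id)
  have closed: "?\<tau> \<circ> \<pi> \<in> column_group \<alpha> t" if "\<pi> \<in> column_group \<alpha> t" for \<pi>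
  proof -
    have "(?\<tau> \<circ> \<pi>) ` tableau_column \<alpha> t l = tableau_column \<alpha> t l" for l
      using that \<tau> unfolding column_group_def by (simp only: mem_Collect_eq flip: image_comp)
    then show ?thesis
      using that \<tau> by (simp add: column_group_def sym_group_carrier permutes_compose)
  qed
  have "(\<Sum>\<pi>\<in>column_group \<alpha> t. of_int (sign \<pi>) * basis_fun (tabloid \<alpha> (?\<tau> \<circ> \<pi> \<circ> t)) T)
      = (\<Sum>\<pi>\<in>column_group \<alpha> t. - (of_int (sign \<pi>) * basis_fun (tabloid \<alpha> (\<pi> \<circ> t)) T))"
    by (rule sum.reindex_bij_witness[where j = "\<lambda>\<pi>. ?\<tau> \<circ> \<pi>" and i = "\<lambda>\<pi>. ?\<tau> \<circ> \<pi>"])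
      (auto simp: closed sgn o_assoc)
  then show "lin_act (sym_group (sum_list \<alpha>)) (tabloids \<alpha>) perm_act (basis_fun ?\<tau>) (polytabloid \<alpha> t) T
    = - polytabloid \<alpha> t T"
    unfolding lin_act_polytabloid_expand[OF t \<tau>S] by (simp add: polytabloid_eq sum_negf)
qed

section \<open>The Specht module as a span of polytabloids\<close>

lemma carrier_specht: "carrier (specht_module \<alpha>) = fun_space.span (polytabloids \<alpha>)"
proof -
  have "(\<Sum>e\<in>F. (\<lambda>T. c e * e T)) = (\<lambda>T. \<Sum>e\<in>F. c e * e T)" 
    for F :: "((nat \<Rightarrow> nat set) \<Rightarrow> complex) set" and c
    by (rule ext) (rule sum_fun_apply)
  then show ?thesis by (simp add: specht_module_def fun_space.span_explicit)
qed

lemma specht_simps: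
  "a \<odot>\<^bsub>specht_module \<alpha>\<^esub> v = lin_act (sym_group (sum_list \<alpha>)) (tabloids \<alpha>) perm_act a v"
  "\<zero>\<^bsub>specht_module \<alpha>\<^esub> = (\<lambda>_. 0)"
  "f \<oplus>\<^bsub>specht_module \<alpha>\<^esub> g = (\<lambda>x. f x + g x)"
  by (simp_all add: specht_module_def tabloid_module_def lin_module_def)

lemma specht_outside:
  assumes "u \<in> carrier (specht_module \<alpha>)" "T \<notin> tabloids \<alpha>"
  shows "u T = 0"
  using assms(1) unfolding carrier_specht
proof (induction u rule: fun_space.span_induct_alt)
  case (step c x y)
  then show ?case using polytabloid_outside assms(2) by (auto simp: polytabloids_def)
qed simp

text \<open>A permutation sends polytabloids to polytabloids and so preserves their span; a general
  element of the group algebra is a combination of permutations.\<close>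

lemma specht_smult_closed:
  assumes a: "a \<in> carrier (monoid_algebra (sym_group (sum_list \<alpha>)))" and u: "u \<in> carrier (specht_module \<alpha>)"
  shows "a \<odot>\<^bsub>specht_module \<alpha>\<^esub> u \<in> carrier (specht_module \<alpha>)"
proof -
  let ?act = "lin_act (sym_group (sum_list \<alpha>)) (tabloids \<alpha>) perm_act"
  have "?act (basis_fun \<sigma>) u \<in> fun_space.span (polytabloids \<alpha>)"
    if \<sigma>: "\<sigma> \<in> carrier (sym_group (sum_list \<alpha>))" for \<sigma>
    using u unfolding carrier_specht
  proof (induction u rule: fun_space.span_induct_alt)
    case base
    have "?act (basis_fun \<sigma>) (\<lambda>_. 0) = (\<lambda>_. 0)"
      using lin_act_scale_right[where c = 0 and f = "\<lambda>_. 0"] by simp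
    then show ?case using fun_space.span_zero[of "polytabloids \<alpha>"] by (simp add: zero_fun_def)
  next
    case (step c x y)
    then obtain t where t: "is_tableau \<alpha> t" "x = polytabloid \<alpha> t" by (auto simp: polytabloids_def)
    have "?act (basis_fun \<sigma>) x \<in> polytabloids \<alpha>"
      using lin_act_polytabloid[OF t(1) \<sigma>] is_tableau_comp[OF t(1) \<sigma>] t(2) by (auto simp: polytabloids_def)
    then have "(\<lambda>T. c * ?act (basis_fun \<sigma>) x T) + ?act (basis_fun \<sigma>) y \<in> fun_space.span (polytabloids \<alpha>)"
      by (intro fun_space.span_add fun_space.span_scale step.IH) (rule fun_space.span_base)
    then show ?case by (simp add: plus_fun_def lin_act_add_right lin_act_scale_right)
  qed
  then have "(\<Sum>\<sigma>\<in>carrier (sym_group (sum_list \<alpha>)). (\<lambda>T. a \<sigma> * ?act (basis_fun \<sigma>) u T))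
      \<in> fun_space.span (polytabloids \<alpha>)"
    by (intro fun_space.span_sum fun_space.span_scale)
  also have "(\<Sum>\<sigma>\<in>carrier (sym_group (sum_list \<alpha>)). (\<lambda>T. a \<sigma> * ?act (basis_fun \<sigma>) u T))
      = ?act (\<lambda>\<pi>. \<Sum>\<sigma>\<in>carrier (sym_group (sum_list \<alpha>)). a \<sigma> * basis_fun \<sigma> \<pi>) u"
    unfolding lin_act_sum_left by (rule ext) (rule sum_fun_apply)
  also have "(\<lambda>\<pi>. \<Sum>\<sigma>\<in>carrier (sym_group (sum_list \<alpha>)). a \<sigma> * basis_fun \<sigma> \<pi>) = a"
    using a basis_fun_expansion[OF finite_sym_group, of _ a] by (simp add: monoid_algebra_simps)
  finally show ?thesis by (simp add: carrier_specht specht_simps)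
qed

lemma specht_add_closed:
  "u \<in> carrier (specht_module \<alpha>) \<Longrightarrow> w \<in> carrier (specht_module \<alpha>) \<Longrightarrow>
    u \<oplus>\<^bsub>specht_module \<alpha>\<^esub> w \<in> carrier (specht_module \<alpha>)"
  using fun_space.span_add[of u "polytabloids \<alpha>" w] by (simp add: carrier_specht specht_simps plus_fun_def)

text \<open>Expresses scalar multiplication inside the group algebra, the form in which the
  balancing relation can move a scalar across the tensor sign.\<close>

lemma specht_scale:
  assumes "u \<in> carrier (specht_module \<alpha>)"
  shows "(\<lambda>s. c * basis_fun id s) \<odot>\<^bsub>specht_module \<alpha>\<^esub> u = (\<lambda>T. c * u T)"
  unfolding specht_simps
  by (rule lin_act_identity)
    (auto simp: finite_sym_group finite_tabloids specht_outside[OF assms] sym_group_carrier permutes_id)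

section \<open>Modules of the monoid of partial functions\<close>

lemma finite_partial_fun_monoid: "finite (carrier (partial_fun_monoid n))"
proof (rule finite_subset)
  show "finite (\<Union>A\<in>Pow {1..n}. {f. dom f = A \<and> ran f \<subseteq> {1..n}})"
  proof (rule finite_UN_I)
    fix A assume "A \<in> Pow {1..n}"
    then have "finite A" using finite_subset by blast
    then show "finite {f :: nat \<rightharpoonup> nat. dom f = A \<and> ran f \<subseteq> {1..n}}"
      by (rule finite_set_of_finite_maps) simp
  qed simp
  show "carrier (partial_fun_monoid n) \<subseteq> (\<Union>A\<in>Pow {1..n}. {f. dom f = A \<and> ran f \<subseteq> {1..n}})"
    by (auto simp: partial_fun_monoid_def)
qed

lemma map_comp_assoc: "(f \<circ>\<^sub>m g) \<circ>\<^sub>m h = f \<circ>\<^sub>m (g \<circ>\<^sub>m h)"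
  by (simp add: map_comp_def fun_eq_iff split: option.split)

lemma map_comp_comp: "f \<circ>\<^sub>m (g \<circ> h) = (f \<circ>\<^sub>m g) \<circ> h"
  by (simp add: map_comp_def fun_eq_iff)

lemma dom_map_comp_subset: "dom (f \<circ>\<^sub>m g) \<subseteq> dom g"
  by (auto simp: map_comp_Some_iff)

lemma ran_map_comp_subset: "ran (f \<circ>\<^sub>m g) \<subseteq> ran f"
  by (auto simp: ran_def map_comp_Some_iff)

lemma map_comp_partial_id_left:
  assumes "ran f \<subseteq> {1..k}"
  shows "partial_id k \<circ>\<^sub>m f = f"
proof
  fix x
  show "(partial_id k \<circ>\<^sub>m f) x = f x"
  proof (cases "f x")
    case (Some y)
    then have "y \<in> {1..k}" using assms ranI by fast
    then show ?thesis using Some by (simp add: partial_id_def)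
  qed simp
qed

lemma map_comp_partial_id_right:
  assumes "dom f \<subseteq> {1..k}"
  shows "f \<circ>\<^sub>m partial_id k = f"
proof
  fix x
  show "(f \<circ>\<^sub>m partial_id k) x = f x"
  proof (cases "x \<in> {1..k}")
    case True
    then show ?thesis by (simp add: partial_id_def map_comp_def)
  next
    case False
    then have "f x = None" using assms by blast
    then show ?thesis using False by (simp add: partial_id_def map_comp_def restrict_map_def)
  qed
qed

lemma dom_partial_id: "dom (partial_id k) = {1..k}"
  by (simp add: partial_id_def)

lemma ran_partial_id: "ran (partial_id k) = {1..k}"
proof
  show "ran (partial_id k) \<subseteq> {1..k}"
    by (rule subsetI) (simp add: partial_id_def ran_def restrict_map_def split: if_splits)
  show "{1..k} \<subseteq> ran (partial_id k)"
  proof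
    fix x assume "x \<in> {1..k}"
    then have "partial_id k x = Some x" by (simp add: partial_id_def)
    then show "x \<in> ran (partial_id k)" by (rule ranI)
  qed
qed

lemma partial_fun_monoid_simps:
  "carrier (partial_fun_monoid n) = {f. dom f \<subseteq> {1..n} \<and> ran f \<subseteq> {1..n}}"
  "f \<otimes>\<^bsub>partial_fun_monoid n\<^esub> g = f \<circ>\<^sub>m g"
  "\<one>\<^bsub>partial_fun_monoid n\<^esub> = partial_id n"
  by (simp_all add: partial_fun_monoid_def partial_id_def)

lemma partial_id_closed: "k \<le> n \<Longrightarrow> partial_id k \<in> carrier (partial_fun_monoid n)"
  by (auto simp: partial_fun_monoid_simps ran_partial_id dom_partial_id)

lemma map_comp_closed:
  "f \<in> carrier (partial_fun_monoid n) \<Longrightarrow> g \<in> carrier (partial_fun_monoid n) \<Longrightarrow>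
    f \<circ>\<^sub>m g \<in> carrier (partial_fun_monoid n)"
  using dom_map_comp_subset[of f g] ran_map_comp_subset[of f g]
  unfolding partial_fun_monoid_simps by blast

lemma monoid_partial_fun_monoid: "monoid (partial_fun_monoid n)"
proof (rule monoidI)
  fix f g
  assume "f \<in> carrier (partial_fun_monoid n)" "g \<in> carrier (partial_fun_monoid n)"
  then show "f \<otimes>\<^bsub>partial_fun_monoid n\<^esub> g \<in> carrier (partial_fun_monoid n)"
    using map_comp_closed[of f n g] by (simp add: partial_fun_monoid_simps(2))
qed (use partial_id_closed[of n n] in
    \<open>simp_all add: partial_fun_monoid_simps map_comp_assoc map_comp_partial_id_left map_comp_partial_id_right\<close>)

section \<open>Induced modules and their generators\<close>

locale PT_induced =
  fixes n :: nat and X :: "(nat \<rightharpoonup> nat) set" and \<alpha> :: "nat list"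
  assumes X_subset: "X \<subseteq> carrier (partial_fun_monoid n)"
begin

abbreviation "PT \<equiv> partial_fun_monoid n"
abbreviation "Sym \<equiv> sym_group (sum_list \<alpha>)"
abbreviation "ract \<equiv> \<lambda>v a. lin_act Sym X (\<lambda>\<sigma> x. x \<circ> \<sigma>) a v"

lemma finite_X: "finite X"
  using finite_subset[OF X_subset finite_partial_fun_monoid] .

sublocale tensor_pair "monoid_algebra Sym" ract "lin_module PT X (\<circ>\<^sub>m)" "specht_module \<alpha>"
  by unfold_locales
    (simp_all add: lin_module_simps lin_act_outside specht_add_closed specht_smult_closed)

lemma induced_module_eq: "induced_module n X \<alpha> = tensor"
  by (simp add: induced_module_def)

lemma basis_fun_carrier: "x \<in> X \<Longrightarrow> (\<lambda>y. c * basis_fun x y) \<in> carrier (lin_module PT X (\<circ>\<^sub>m))"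
  by (auto simp: lin_module_simps basis_fun_def)

lemma polytabloid_carrier: "is_tableau \<alpha> t \<Longrightarrow> polytabloid \<alpha> t \<in> carrier (specht_module \<alpha>)"
  unfolding carrier_specht by (rule fun_space.span_base) (auto simp: polytabloids_def)

lemma span_basis_carrier:
  assumes "v \<in> fun_space.span (basis_fun ` Y)" "Y \<subseteq> X"
  shows "v \<in> carrier (lin_module PT X (\<circ>\<^sub>m))"
  using assms(1)
proof (induction v rule: fun_space.span_induct_alt)
  case (step c x y)
  then show ?case using assms(2) by (auto simp: lin_module_simps basis_fun_def split: if_splits)
qed (simp add: lin_module_simps)

text \<open>Used twice: with \<open>H = {rels}\<close> and \<open>Y\<close> the functions with range
  in \<open>{1..r}\<close> for the annihilation by \<open>E\<close>, and with \<open>H\<close> a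
  complex span and \<open>Y = X\<close> for finite dimension. The scalars of both expansions are
  collected on the left factor, where the base case admits one.\<close>

lemma pure_mem_if_span:
  assumes Y: "Y \<subseteq> X"
    and zero: "rels \<in> H" and add: "\<And>x y. x \<in> H \<Longrightarrow> y \<in> H \<Longrightarrow> x \<oplus>\<^bsub>tensor\<^esub> y \<in> H"
    and base: "\<And>c y t. y \<in> Y \<Longrightarrow> is_tableau \<alpha> t \<Longrightarrow> pure (\<lambda>x. c * basis_fun y x) (polytabloid \<alpha> t) \<in> H"
    and v: "v \<in> fun_space.span (basis_fun ` Y)" and u: "u \<in> carrier (specht_module \<alpha>)"
  shows "pure v u \<in> H"
proof -
  have left: "pure w (polytabloid \<alpha> t) \<in> H"
    if t: "is_tableau \<alpha> t" and w: "w \<in> fun_space.span (basis_fun ` Y)" for w t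
  proof -
    \<comment> \<open>Membership in the carrier is carried through the induction because additivity
      of \<open>pure\<close> is available only there.\<close>
    define Q where "Q w \<longleftrightarrow> w \<in> carrier (lin_module PT X (\<circ>\<^sub>m)) \<and> pure w (polytabloid \<alpha> t) \<in> H" for w
    have "Q w"
      using w
    proof (induction w rule: fun_space.span_induct_alt)
      case base
      have "pure (0 :: (nat \<rightharpoonup> nat) \<Rightarrow> complex) (polytabloid \<alpha> t) = rels"
        using polytabloid_carrier[OF t] by (intro pure_idem_left) (auto simp: lin_module_simps)
      then have "pure 0 (polytabloid \<alpha> t) \<in> H" using zero by (simp only:)
      moreover have "0 \<in> carrier (lin_module PT X (\<circ>\<^sub>m))" by (simp add: lin_module_simps)
      ultimately show ?case by (simp only: Q_def)
    next
      case (step c x y)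
      then obtain p where p: "p \<in> Y" "x = basis_fun p" by blast
      have y: "y \<in> carrier (lin_module PT X (\<circ>\<^sub>m))" "pure y (polytabloid \<alpha> t) \<in> H"
        using step.IH by (simp_all only: Q_def)
      have p': "(\<lambda>q. c * basis_fun p q) \<in> carrier (lin_module PT X (\<circ>\<^sub>m))"
        using p(1) Y by (intro basis_fun_carrier) blast
      have "pure ((\<lambda>q. c * basis_fun p q) + y) (polytabloid \<alpha> t)
          = pure (\<lambda>q. c * basis_fun p q) (polytabloid \<alpha> t) \<oplus>\<^bsub>tensor\<^esub> pure y (polytabloid \<alpha> t)"
        using pure_add_left[OF p' _ polytabloid_carrier[OF t], of y] y(1)
        by (simp add: lin_module_simps plus_fun_def)
      also have "\<dots> \<in> H" using y(2) by (intro add base p(1) t)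
      finally have "pure ((\<lambda>q. c * basis_fun p q) + y) (polytabloid \<alpha> t) \<in> H" .
      moreover have "(\<lambda>q. c * basis_fun p q) + y \<in> carrier (lin_module PT X (\<circ>\<^sub>m))"
        using p' y(1) by (simp add: lin_module_simps)
      ultimately show ?case unfolding p(2) by (simp only: Q_def)
    qed
    then show ?thesis by (simp only: Q_def)
  qed
  have v': "v \<in> carrier (lin_module PT X (\<circ>\<^sub>m))" by (rule span_basis_carrier[OF v Y])
  define Q where "Q u \<longleftrightarrow> u \<in> carrier (specht_module \<alpha>) \<and> pure v u \<in> H" for u
  have "Q u"
    using u unfolding carrier_specht
  proof (induction u rule: fun_space.span_induct_alt)
    case base
    have "pure v (0 :: (nat \<Rightarrow> nat set) \<Rightarrow> complex) = rels"
      using v' fun_space.span_zero[of "polytabloids \<alpha>"]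
      by (intro pure_idem_right) (auto simp: carrier_specht specht_simps)
    then have "pure v 0 \<in> H" using zero by (simp only:)
    then show ?case using fun_space.span_zero[of "polytabloids \<alpha>"] by (simp only: Q_def carrier_specht)
  next
    case (step c x y)
    then obtain t where t: "is_tableau \<alpha> t" "x = polytabloid \<alpha> t" by (auto simp: polytabloids_def)
    have x: "x \<in> carrier (specht_module \<alpha>)" using polytabloid_carrier[OF t(1)] t(2) by simp
    have y: "y \<in> carrier (specht_module \<alpha>)" "pure v y \<in> H" using step.IH by (simp_all only: Q_def)
    \<comment> \<open>Scaling \<open>x\<close> by \<open>c\<close> is the action of this element of
      the group algebra, so balancing hands \<open>c\<close> over to \<open>v\<close>, whose span is
      closed under scaling.\<close>
    let ?c = "\<lambda>s. c * basis_fun id s"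
    have c: "?c \<in> carrier (monoid_algebra Sym)"
      by (auto simp: monoid_algebra_simps basis_fun_def sym_group_carrier permutes_id)
    have cx: "(\<lambda>T. c * x T) \<in> carrier (specht_module \<alpha>)"
      using smult_closed_N[OF c x] specht_scale[OF x] by simp
    have "ract v ?c = (\<lambda>q. c * v q)"
      using v' by (intro lin_act_identity)
        (auto simp: finite_sym_group finite_X sym_group_carrier permutes_id lin_module_simps)
    then have "pure v (\<lambda>T. c * x T) = pure (\<lambda>q. c * v q) x"
      using pure_balanced[OF v' c x] specht_scale[OF x] by simp
    also have "\<dots> \<in> H"
      unfolding t(2) by (rule left[OF t(1)]) (rule fun_space.span_scale[OF v])
    finally have "pure v (\<lambda>T. c * x T) \<oplus>\<^bsub>tensor\<^esub> pure v y \<in> H" using y(2) by (rule add)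
    then have "pure v ((\<lambda>T. c * x T) + y) \<in> H"
      using pure_add_right[OF v' cx y(1)] by (simp add: specht_simps plus_fun_def)
    moreover have "(\<lambda>T. c * x T) + y \<in> carrier (specht_module \<alpha>)"
      using add_closed_N[OF cx y(1)] by (simp add: specht_simps plus_fun_def)
    ultimately show ?case by (simp only: Q_def)
  qed
  then show ?thesis by (simp only: Q_def)
qed

end

section \<open>The projective modules\<close>

lemma one_map_comp: "f \<in> carrier (partial_fun_monoid n) \<Longrightarrow> \<one>\<^bsub>partial_fun_monoid n\<^esub> \<circ>\<^sub>m f = f"
  unfolding partial_fun_monoid_simps by (intro map_comp_partial_id_left) simp

lemma L_tilde_class_id_iff:
  "x \<in> L_tilde_class_id n k \<longleftrightarrow> x \<in> carrier (partial_fun_monoid n) \<and> dom x = {1..k}"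
  by (simp add: L_tilde_class_id_def)

text \<open>A permutation of \<open>{1..k}\<close> pulls a domain back to \<open>{1..k}\<close> only
  if that domain was \<open>{1..k}\<close>. From right to left this closes the class under the right
  action; from left to right it supplies the condition \<open>stay\<close> of
  \<open>lin_act_commute\<close>.\<close>

lemma L_tilde_class_comp_perm:
  assumes x: "x \<in> carrier (partial_fun_monoid n)" and k: "k \<le> n" and \<sigma>: "\<sigma> permutes {1..k}"
  shows "x \<circ> \<sigma> \<in> L_tilde_class_id n k \<longleftrightarrow> x \<in> L_tilde_class_id n k"
proof -
  have dom: "dom (x \<circ> \<sigma>) = \<sigma> -` dom x" by auto
  have "dom (x \<circ> \<sigma>) = {1..k} \<longleftrightarrow> dom x = {1..k}"
  proof
    assume "dom (x \<circ> \<sigma>) = {1..k}"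
    then have "\<sigma> ` (\<sigma> -` dom x) = \<sigma> ` {1..k}" using dom by simp
    then show "dom x = {1..k}"
      using surj_image_vimage_eq[OF permutes_surj[OF \<sigma>]] permutes_image[OF \<sigma>] by simp
  next
    assume "dom x = {1..k}"
    then show "dom (x \<circ> \<sigma>) = {1..k}" using dom permutes_vimage[OF \<sigma>] by simp
  qed
  moreover have "x \<circ> \<sigma> \<in> carrier (partial_fun_monoid n)" if "dom (x \<circ> \<sigma>) = {1..k}"
  proof -
    have "ran (x \<circ> \<sigma>) \<subseteq> ran x" unfolding ran_def by (rule subsetI) auto
    also have "\<dots> \<subseteq> {1..n}" using x by (simp add: partial_fun_monoid_simps)
    finally show ?thesis using that k by (simp add: partial_fun_monoid_simps)
  qed
  ultimately show ?thesis using x unfolding L_tilde_class_id_iff by blast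
qed

locale PT_projective_induced = PT_induced n "L_tilde_class_id n (sum_list \<alpha>)" \<alpha> for n \<alpha> +
  assumes size_le: "sum_list \<alpha> \<le> n"
begin

abbreviation "X \<equiv> L_tilde_class_id n (sum_list \<alpha>)"

sublocale tensor_left_module "monoid_algebra PT" "monoid_algebra Sym" ract "lin_module PT X (\<circ>\<^sub>m)"
  "specht_module \<alpha>"
proof (intro tensor_left_module.intro tensor_left_module_axioms.intro)
  show "tensor_pair (monoid_algebra Sym) ract (lin_module PT X (\<circ>\<^sub>m)) (specht_module \<alpha>)"
    by (rule tensor_pair_axioms)
  show "left_module (monoid_algebra PT) (lin_module PT X (\<circ>\<^sub>m))"
  proof (rule left_module_lin_module)
    show "\<one>\<^bsub>PT\<^esub> \<circ>\<^sub>m x = x" if "x \<in> X" for x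
        using that X_subset by (intro one_map_comp) blast
    show "(s \<otimes>\<^bsub>PT\<^esub> t) \<circ>\<^sub>m x = s \<circ>\<^sub>m (t \<circ>\<^sub>m x)" for s t x
      by (simp add: partial_fun_monoid_simps map_comp_assoc)
    \<comment> \<open>Composing on the left can only shrink the domain, so if it is still all of
      \<open>{1..k}\<close> at the end, it was so in between.\<close>
    show "t \<circ>\<^sub>m x \<in> X" if "t \<in> carrier PT" "x \<in> X" "s \<circ>\<^sub>m (t \<circ>\<^sub>m x) \<in> X" for s t x
    proof -
      have "dom (t \<circ>\<^sub>m x) = {1..sum_list \<alpha>}"
        using that(2,3) dom_map_comp_subset[of s "t \<circ>\<^sub>m x"] dom_map_comp_subset[of t x]
        unfolding L_tilde_class_id_iff by blast
      then show ?thesis using that map_comp_closed[of t n x] by (simp add: L_tilde_class_id_iff)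
    qed
  qed (simp_all add: monoid_partial_fun_monoid finite_partial_fun_monoid finite_X)
  fix a s m
  show "a \<odot>\<^bsub>lin_module PT X (\<circ>\<^sub>m)\<^esub> ract m s = ract (a \<odot>\<^bsub>lin_module PT X (\<circ>\<^sub>m)\<^esub> m) s"
    unfolding lin_module_simps
  proof (rule lin_act_commute)
    show "x \<circ> \<sigma> \<in> X" if "\<sigma> \<in> carrier Sym" "x \<in> X" for \<sigma> x
      using that L_tilde_class_comp_perm[OF _ size_le, of x \<sigma>]
      by (simp add: L_tilde_class_id_iff[of x] sym_group_carrier)
    show "f \<circ>\<^sub>m x \<in> X" if "f \<in> carrier PT" "\<sigma> \<in> carrier Sym" "x \<in> X" "(f \<circ>\<^sub>m x) \<circ> \<sigma> \<in> X" for f \<sigma> x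
      using that L_tilde_class_comp_perm[OF map_comp_closed size_le, of f x \<sigma>]
      by (simp add: L_tilde_class_id_iff[of x] sym_group_carrier)
  qed (simp_all add: finite_partial_fun_monoid finite_sym_group finite_X map_comp_comp)
qed

lemma pure_polytabloid_eq_zero:
  assumes \<alpha>: "0 \<notin> set \<alpha>" and y: "y \<in> X" "ran y \<subseteq> {1..r}" and r: "r < length \<alpha>" and t: "is_tableau \<alpha> t"
  shows "pure (\<lambda>x. c * basis_fun y x) (polytabloid \<alpha> t) = rels"
proof -
  let ?P = "polytabloid \<alpha> t"
  \<comment> \<open>No part is zero, so the first column meets every one of the
    \<open>length \<alpha>\<close> rows.\<close>
  have diag: "(i, 0) \<in> young_diagram \<alpha>" if "i < length \<alpha>" for i
  proof -
    have "\<alpha> ! i \<noteq> 0" using \<alpha> nth_mem[OF that] by metis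
    then show ?thesis using that by (simp add: young_diagram_def)
  qed
  have entry: "t (i, 0) \<in> dom y" if "i < length \<alpha>" for i
    using t diag[OF that] y(1) unfolding is_tableau_def bij_betw_def L_tilde_class_id_iff by blast
  define f where "f i = the (y (t (i, 0)))" for i
  have f: "y (t (i, 0)) = Some (f i)" if "i < length \<alpha>" for i
    using entry[OF that] by (auto simp: f_def)
  have "f ` {..<length \<alpha>} \<subseteq> {1..r}" using f y(2) by (auto intro: ranI)
  then have "card (f ` {..<length \<alpha>}) \<le> r" using card_mono[of "{1..r}"] by simp
  then have "\<not> inj_on f {..<length \<alpha>}" using r by (intro pigeonhole) simp
  then obtain i j where ij: "i < length \<alpha>" "j < length \<alpha>" "i \<noteq> j" "f i = f j"
    by (auto simp: inj_on_def)
  define \<tau> where "\<tau> = transpose (t (i, 0)) (t (j, 0))"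
  have \<tau>: "\<tau> \<in> carrier Sym"
    unfolding \<tau>_def using transpose_in_column_group[OF t diag diag] ij column_group_subset by blast
  have y\<tau>: "y \<circ> \<tau> = y"
    using f[OF ij(1)] f[OF ij(2)] ij(4) by (auto simp: \<tau>_def fun_eq_iff transpose_def)
  have basis\<tau>: "basis_fun \<tau> \<in> carrier (monoid_algebra Sym)"
    using \<tau> by (auto simp: monoid_algebra_simps basis_fun_def)
  have P: "?P \<in> carrier (specht_module \<alpha>)" by (rule polytabloid_carrier[OF t])
  have \<tau>P: "basis_fun \<tau> \<odot>\<^bsub>specht_module \<alpha>\<^esub> ?P = (\<lambda>T. - ?P T)"
    unfolding specht_simps \<tau>_def using ij by (intro lin_act_transpose_polytabloid[OF t diag diag])
  have mP: "(\<lambda>T. - ?P T) \<in> carrier (specht_module \<alpha>)"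
    using smult_closed_N[OF basis\<tau> P] \<tau>P by simp
  \<comment> \<open>The transposition shows that \<open>pure v ?P\<close> equals
    \<open>pure v (- ?P)\<close>, so that its double vanishes; torsion in the abelian group has not
    been excluded. With half of the coefficient in \<open>v\<close>, the doubled tensor is the
    wanted one.\<close>
  define v where "v = (\<lambda>x. (c / 2) * basis_fun y x)"
  have v: "v \<in> carrier (lin_module PT X (\<circ>\<^sub>m))" unfolding v_def by (rule basis_fun_carrier[OF y(1)])
  have "ract v (basis_fun \<tau>) = v"
    unfolding v_def lin_act_scale_right
    using \<tau> y(1) y\<tau> by (simp add: lin_act_basis_basis finite_sym_group finite_X)
  then have "pure v ?P = pure v (\<lambda>T. - ?P T)"
    using pure_balanced[OF v basis\<tau> P] \<tau>P by simp
  then have "pure v ?P \<oplus>\<^bsub>tensor\<^esub> pure v ?P = pure v ?P \<oplus>\<^bsub>tensor\<^esub> pure v (\<lambda>T. - ?P T)" by simp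
  also have "\<dots> = pure v (?P \<oplus>\<^bsub>specht_module \<alpha>\<^esub> (\<lambda>T. - ?P T))" using pure_add_right[OF v P mP] by simp
  also have "\<dots> = rels"
    by (rule pure_idem_right[OF v add_closed_N[OF P mP]]) (simp add: specht_simps)
  finally have "pure (v \<oplus>\<^bsub>lin_module PT X (\<circ>\<^sub>m)\<^esub> v) ?P = rels" using pure_add_left[OF v v P] by simp
  moreover have "v \<oplus>\<^bsub>lin_module PT X (\<circ>\<^sub>m)\<^esub> v = (\<lambda>x. c * basis_fun y x)"
    by (simp add: lin_module_simps v_def fun_eq_iff)
  ultimately show ?thesis by simp
qed

lemma partial_id_annihilates:
  assumes \<alpha>: "0 \<notin> set \<alpha>" and r: "r < length \<alpha>" "r \<le> n" and x: "x \<in> carrier tensor"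
  shows "basis_fun (partial_id r) \<odot>\<^bsub>tensor\<^esub> x = \<zero>\<^bsub>tensor\<^esub>"
proof -
  interpret T: left_module "monoid_algebra PT" tensor by (rule left_module_tensor)
  let ?E = "basis_fun (partial_id r)"
  have E: "?E \<in> carrier (monoid_algebra PT)"
    using partial_id_closed[OF r(2)] by (auto simp: monoid_algebra_simps basis_fun_def)
  define Q where "Q x \<longleftrightarrow> x \<in> carrier tensor \<and> ?E \<odot>\<^bsub>tensor\<^esub> x = \<zero>\<^bsub>tensor\<^esub>" for x
  have "Q x"
    using x
  proof (induction x rule: tensor_induct)
    case zero
    show ?case using T.smult_r_zero[OF E] T.M.zero_closed by (simp only: Q_def)
  next
    case (add x y)
    then have xy: "x \<in> carrier tensor" "?E \<odot>\<^bsub>tensor\<^esub> x = \<zero>\<^bsub>tensor\<^esub>"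
      "y \<in> carrier tensor" "?E \<odot>\<^bsub>tensor\<^esub> y = \<zero>\<^bsub>tensor\<^esub>" by (simp_all only: Q_def)
    have "?E \<odot>\<^bsub>tensor\<^esub> (x \<oplus>\<^bsub>tensor\<^esub> y) = \<zero>\<^bsub>tensor\<^esub>"
      unfolding T.smult_r_distr[OF E xy(1,3)] xy(2,4) by (rule T.M.r_zero[OF T.M.zero_closed])
    then show ?case using T.M.a_closed[OF xy(1,3)] by (simp only: Q_def)
  next
    case (uminus x)
    then have x: "x \<in> carrier tensor" "?E \<odot>\<^bsub>tensor\<^esub> x = \<zero>\<^bsub>tensor\<^esub>" by (simp_all only: Q_def)
    note x' = T.M.a_inv_closed[OF x(1)]
    have "?E \<odot>\<^bsub>tensor\<^esub> x \<oplus>\<^bsub>tensor\<^esub> ?E \<odot>\<^bsub>tensor\<^esub> (\<ominus>\<^bsub>tensor\<^esub> x) = \<zero>\<^bsub>tensor\<^esub>"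
      unfolding T.smult_r_distr[OF E x(1) x', symmetric] T.M.r_neg[OF x(1)] by (rule T.smult_r_zero[OF E])
    then have "?E \<odot>\<^bsub>tensor\<^esub> (\<ominus>\<^bsub>tensor\<^esub> x) = \<zero>\<^bsub>tensor\<^esub>"
      unfolding x(2) T.M.l_zero[OF T.smult_closed[OF E x']] .
    then show ?case using x' by (simp only: Q_def)
  next
    case (pure v u)
    \<comment> \<open>The support of \<open>E v\<close> is read off from the results: every
      composite with \<open>partial_id r\<close> on the left has range in \<open>{1..r}\<close>,
      whichever function it came from.\<close>
    let ?Y = "{y \<in> X. ran y \<subseteq> {1..r}}"
    have "lin_act PT X (\<circ>\<^sub>m) ?E v y = 0" if "y \<notin> ?Y" for y
    proof (cases "y \<in> X")
      case True
      then have "partial_id r \<circ>\<^sub>m x \<noteq> y" for x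
        using that ran_map_comp_subset[of "partial_id r" x] unfolding ran_partial_id by blast
      then show ?thesis
        using True partial_id_closed[OF r(2)] finite_X finite_partial_fun_monoid
        by (simp add: lin_act_basis_left)
    qed (simp add: lin_act_outside)
    then have "lin_act PT X (\<circ>\<^sub>m) ?E v \<in> fun_space.span (basis_fun ` ?Y)"
      using finite_subset[OF _ finite_X, of ?Y] by (intro in_span_basis_fun) blast+
    then have "pure (lin_act PT X (\<circ>\<^sub>m) ?E v) u \<in> {rels}"
    proof (rule pure_mem_if_span[rotated 4])
      show "x \<oplus>\<^bsub>tensor\<^esub> y \<in> {rels}" if "x \<in> {rels}" "y \<in> {rels}" for x y
        using that T.M.r_zero[OF T.M.zero_closed] by (simp add: zero_tensor)
      show "pure (\<lambda>x. c * basis_fun y x) (polytabloid \<alpha> t) \<in> {rels}"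
        if "y \<in> ?Y" "is_tableau \<alpha> t" for c y t
        using that pure_polytabloid_eq_zero[OF \<alpha> _ _ r(1)] by blast
    qed (use pure(2) in blast)+
    then have "?E \<odot>\<^bsub>tensor\<^esub> pure v u = \<zero>\<^bsub>tensor\<^esub>"
      using smult_pure[OF E pure] by (simp add: zero_tensor lin_module_simps(2))
    then show ?case using pure_carrier[OF pure] by (simp only: Q_def)
  qed
  then show ?thesis by (simp only: Q_def)
qed

text \<open>The tensors of a basis function with a polytabloid are finite in number and span over
  the complex numbers, so \<open>span_rank\<close> of a list of them is a measure on
  submodules.\<close>

lemma composition_series_tensor: "\<exists>Ns. composition_series (monoid_algebra PT) tensor Ns"
proof -
  interpret T: left_module "monoid_algebra PT" tensor by (rule left_module_tensor)
  define F where "F c = (\<lambda>f. c * basis_fun \<one>\<^bsub>PT\<^esub> f)" for c :: complex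
  have one: "\<one>\<^bsub>PT\<^esub> \<in> carrier PT" using partial_id_closed[of n n] by (simp add: partial_fun_monoid_simps(3))
  interpret T: field_module "monoid_algebra PT" tensor F
    unfolding F_def
    by (rule field_module_monoid_algebra[OF monoid_partial_fun_monoid finite_partial_fun_monoid left_module_tensor])
  obtain bs where bs: "set bs = (\<lambda>(x, e). pure (basis_fun x) e) ` (X \<times> polytabloids \<alpha>)"
    using finite_list[of "(\<lambda>(x, e). pure (basis_fun x) e) ` (X \<times> polytabloids \<alpha>)"]
      finite_X finite_polytabloids[of \<alpha>] by auto
  have basis: "basis_fun x \<in> carrier (lin_module PT X (\<circ>\<^sub>m))" if "x \<in> X" for x
    using basis_fun_carrier[OF that, of 1] by simp
  have bs_carrier: "set bs \<subseteq> carrier tensor"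
    unfolding bs using pure_carrier[OF basis polytabloid_carrier] by (auto simp: polytabloids_def)
  define H where "H = T.list_span bs"
  have H: "\<zero>\<^bsub>tensor\<^esub> \<in> H" "\<And>x y. x \<in> H \<Longrightarrow> y \<in> H \<Longrightarrow> x \<oplus>\<^bsub>tensor\<^esub> y \<in> H"
    "\<And>x. x \<in> H \<Longrightarrow> \<ominus>\<^bsub>tensor\<^esub> x \<in> H" "\<And>x. x \<in> set bs \<Longrightarrow> x \<in> H"
    "\<And>c x. x \<in> H \<Longrightarrow> F c \<odot>\<^bsub>tensor\<^esub> x \<in> H"
    unfolding H_def
    by (fact T.list_span_zero[OF bs_carrier] T.list_span_add[OF bs_carrier]
        T.list_span_uminus[OF bs_carrier] T.list_span_base[OF bs_carrier]
        T.list_span_smult[OF bs_carrier])+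
  have "x \<in> H" if "x \<in> carrier tensor" for x
    using that
  proof (induction x rule: tensor_induct)
    case (pure v u)
    show ?case
    proof (rule pure_mem_if_span[of X])
      fix c y t assume yt: "y \<in> X" "is_tableau \<alpha> t"
      \<comment> \<open>The scalar on the left factor is the action of \<open>F c\<close>, so it can
        be pulled out in front of the tensor, and the span absorbs it.\<close>
      have "F c \<odot>\<^bsub>lin_module PT X (\<circ>\<^sub>m)\<^esub> basis_fun y = (\<lambda>x. c * basis_fun y x)"
        unfolding F_def lin_module_simps
      proof (rule lin_act_identity)
        show "\<one>\<^bsub>PT\<^esub> \<circ>\<^sub>m x = x" if "x \<in> X" for x
          using that X_subset by (intro one_map_comp) blast
      qed (use yt one in \<open>auto simp: finite_partial_fun_monoid finite_X basis_fun_def\<close>)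
      then have "pure (\<lambda>x. c * basis_fun y x) (polytabloid \<alpha> t)
          = F c \<odot>\<^bsub>tensor\<^esub> pure (basis_fun y) (polytabloid \<alpha> t)"
        using smult_pure[OF T.F_closed basis polytabloid_carrier] yt by simp
      moreover have "pure (basis_fun y) (polytabloid \<alpha> t) \<in> H"
        using yt by (intro H(4)) (auto simp: bs polytabloids_def)
      ultimately show "pure (\<lambda>x. c * basis_fun y x) (polytabloid \<alpha> t) \<in> H"
        using H(5) by simp
    next
      show "v \<in> fun_space.span (basis_fun ` X)"
        using pure(1) finite_X by (intro in_span_basis_fun) (auto simp: lin_module_simps)
      show "rels \<in> H" using H(1) by (simp only: zero_tensor)
    qed (fact subset_refl H(2) pure(2))+
  qed (fact H(1) | rule H(2,3), assumption+)+
  then have "carrier tensor \<subseteq> T.list_span bs" unfolding H_def by blast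
  then show ?thesis
    by (intro composition_series_exists[OF left_module_tensor, of "T.span_rank bs"]
        T.span_rank_strict_mono[OF _ _ _ bs_carrier])
qed

end

section \<open>The simple modules and the composition factors\<close>

lemma L_class_id_cases:
  assumes "x \<in> L_class_id n k"
  shows "x \<in> carrier (partial_fun_monoid n)" "x \<circ>\<^sub>m partial_id k = x"
proof -
  show x: "x \<in> carrier (partial_fun_monoid n)"
    using assms by (simp add: L_class_id_def green_L_class_def)
  \<comment> \<open>\<open>x\<close> lies in its own principal left ideal, which is that of
    \<open>partial_id k\<close>. Hence \<open>x\<close> is some \<open>s\<close> composed with
    \<open>partial_id k\<close>, and the latter is idempotent.\<close>
  have "x = \<one>\<^bsub>partial_fun_monoid n\<^esub> \<otimes>\<^bsub>partial_fun_monoid n\<^esub> x"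
    using one_map_comp[OF x] by (simp add: partial_fun_monoid_simps(2))
  then have "x \<in> {s \<otimes>\<^bsub>partial_fun_monoid n\<^esub> x | s. s \<in> carrier (partial_fun_monoid n)}"
    using monoid.one_closed[OF monoid_partial_fun_monoid] by blast
  moreover have "{s \<otimes>\<^bsub>partial_fun_monoid n\<^esub> x | s. s \<in> carrier (partial_fun_monoid n)}
      = {s \<otimes>\<^bsub>partial_fun_monoid n\<^esub> partial_id k | s. s \<in> carrier (partial_fun_monoid n)}"
    using assms by (simp add: L_class_id_def green_L_class_def)
  ultimately have "x \<in> {s \<otimes>\<^bsub>partial_fun_monoid n\<^esub> partial_id k | s. s \<in> carrier (partial_fun_monoid n)}"
    by (simp only:)
  then obtain s where "x = s \<circ>\<^sub>m partial_id k" by (auto simp: partial_fun_monoid_simps(2))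
  then show "x \<circ>\<^sub>m partial_id k = x"
    by (simp add: map_comp_assoc map_comp_partial_id_left ran_partial_id)
qed

lemma partial_id_in_L_class_id: "k \<le> n \<Longrightarrow> partial_id k \<in> L_class_id n k"
  by (simp add: L_class_id_def green_L_class_def partial_id_closed)

text \<open>The generator \<open>d\<close> of \<open>trivial_if_annihilated\<close> is
  \<open>E\<close> again, now read as a vector in the span of the L-class instead of an element of
  the algebra.\<close>

lemma trivial_if_isomorphic_PT_simple:
  fixes n :: nat and \<alpha> :: "nat list"
  defines "A \<equiv> monoid_algebra (partial_fun_monoid n)"
    and "E \<equiv> basis_fun (partial_id (sum_list \<alpha>))"
  assumes le: "sum_list \<alpha> \<le> n" and C: "left_module A C"
    and iso: "module_isomorphic A C (PT_simple n \<alpha>)"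
    and kill: "\<And>x. x \<in> carrier C \<Longrightarrow> E \<odot>\<^bsub>C\<^esub> x = \<zero>\<^bsub>C\<^esub>"
  shows "carrier C = {\<zero>\<^bsub>C\<^esub>}"
proof -
  let ?k = "sum_list \<alpha>"
  let ?X = "L_class_id n ?k"
  interpret PT_induced n ?X \<alpha>
    by unfold_locales (auto simp: L_class_id_cases)
  obtain h where h: "h \<in> iso (add_monoid C) (add_monoid tensor)"
    and hom: "\<And>a x. a \<in> carrier A \<Longrightarrow> x \<in> carrier C \<Longrightarrow> h (a \<odot>\<^bsub>C\<^esub> x) = a \<odot>\<^bsub>tensor\<^esub> h x"
    using iso by (auto simp: module_isomorphic_def PT_simple_def induced_module_eq)
  have id: "partial_id ?k \<in> ?X" by (rule partial_id_in_L_class_id[OF le])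
  show ?thesis
  proof (rule trivial_if_annihilated[OF C h hom _ kill])
    show "E \<in> carrier A"
      using partial_id_closed[OF le] by (auto simp: A_def E_def monoid_algebra_simps basis_fun_def)
    show "E \<in> carrier (lin_module PT ?X (\<circ>\<^sub>m))"
      using basis_fun_carrier[OF id, of 1] by (simp add: E_def)
    show "E \<odot>\<^bsub>lin_module PT ?X (\<circ>\<^sub>m)\<^esub> E = E"
      using id partial_id_closed[OF le] L_class_id_cases(2)[OF id]
      by (simp add: E_def lin_module_simps lin_act_basis_basis finite_partial_fun_monoid finite_X)
    \<comment> \<open>The algebra element that produces \<open>m\<close> from \<open>E\<close> is
      \<open>m\<close> itself, since every function of the L-class is fixed by right composition
      with the partial identity.\<close>
    fix m assume m: "m \<in> carrier (lin_module PT ?X (\<circ>\<^sub>m))"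
    have "m = (\<lambda>y. \<Sum>x\<in>?X. m x * basis_fun x y)"
      using m by (intro basis_fun_expansion finite_X) (simp add: lin_module_simps)
    then have "lin_act PT ?X (\<circ>\<^sub>m) m E = lin_act PT ?X (\<circ>\<^sub>m) (\<lambda>y. \<Sum>x\<in>?X. m x * basis_fun x y) E" by simp
    also have "\<dots> = (\<lambda>y. \<Sum>x\<in>?X. m x * basis_fun x y)"
      unfolding lin_act_sum_left E_def using id L_class_id_cases
      by (intro ext sum.cong refl) (simp add: lin_act_basis_basis finite_partial_fun_monoid finite_X)
    finally have "m \<odot>\<^bsub>lin_module PT ?X (\<circ>\<^sub>m)\<^esub> E = m"
      using \<open>m = _\<close> by (simp add: lin_module_simps)
    moreover have "m \<in> carrier A"
      using m X_subset by (auto simp: A_def monoid_algebra_simps lin_module_simps)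
    ultimately show "\<exists>a\<in>carrier A. a \<odot>\<^bsub>lin_module PT ?X (\<circ>\<^sub>m)\<^esub> E = m" by blast
  qed
qed

text \<open>The action on a factor is computed on representatives, and these are elements of
  \<open>M\<close>.\<close>

lemma chain_factor_annihilated:
  assumes M: "left_module A M" and Ns: "composition_series A M Ns" and i: "Suc i < length Ns"
    and E: "E \<in> carrier A" "\<And>x. x \<in> carrier M \<Longrightarrow> E \<odot>\<^bsub>M\<^esub> x = \<zero>\<^bsub>M\<^esub>"
    and x: "x \<in> carrier (chain_factor M Ns i)"
  shows "E \<odot>\<^bsub>chain_factor M Ns i\<^esub> x = \<zero>\<^bsub>chain_factor M Ns i\<^esub>"
proof -
  interpret left_module A M by fact
  have N: "submodule (Ns ! i) A M" and L: "submodule (Ns ! Suc i) A M" and NL: "Ns ! i \<subseteq> Ns ! Suc i"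
    using Ns i by (auto simp: composition_series_def)
  interpret stable_subgroup A "Ns ! i" "M\<lparr>carrier := Ns ! Suc i\<rparr>"
    by (rule stable_subgroup_submodule[OF left_module_submodule[OF L] submodule_restrict[OF M L N NL]])
  obtain y where y: "y \<in> Ns ! Suc i" "x = Ns ! i +>\<^bsub>M\<lparr>carrier := Ns ! Suc i\<rparr>\<^esub> y"
    using x by (auto simp: chain_factor_def carrier_quot)
  then have "E \<odot>\<^bsub>M\<^esub> y = \<zero>\<^bsub>M\<^esub>" using E(2) submodule_subset[OF L] by blast
  then show ?thesis
    using smult_quot[OF E(1), of y] y coset_eq_N[of "\<zero>\<^bsub>M\<^esub>"] submodule_zero[OF N] submodule_zero[OF L]
    by (simp add: chain_factor_def zero_quot)
qed

theorem proposition7p7: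
  fixes n r k :: nat and \<alpha> \<beta> :: "nat list"
  assumes "n \<ge> 1" and "r \<le> n" and "k \<le> n"
    and "is_partition \<alpha> r" and "is_partition \<beta> k"
    and "r < length \<beta>"
  shows "PT_cartan_matrix n \<alpha> \<beta> = 0"
proof -
  have \<alpha>: "sum_list \<alpha> = r" and \<beta>: "sum_list \<beta> = k" "0 \<notin> set \<beta>"
    using assms(4,5) by (auto simp: is_partition_def)
  interpret PT_projective_induced n \<beta>
    using assms(3) \<beta> by unfold_locales (auto simp: L_tilde_class_id_def)
  let ?A = "monoid_algebra (partial_fun_monoid n)" and ?P = "PT_projective n \<beta>"
  have P: "?P = tensor" by (simp add: PT_projective_def induced_module_eq)
  \<comment> \<open>The same choice as in \<open>jh_multiplicity\<close>, so that the set counted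
    there is the one shown to be empty.\<close>
  define Ns where "Ns = (SOME Ns. composition_series ?A ?P Ns)"
  have Ns: "composition_series ?A ?P Ns"
    unfolding Ns_def P by (rule someI_ex) (rule composition_series_tensor)
  have "\<not> module_isomorphic ?A (chain_factor ?P Ns i) (PT_simple n \<alpha>)" if i: "Suc i < length Ns" for i
  proof
    assume iso: "module_isomorphic ?A (chain_factor ?P Ns i) (PT_simple n \<alpha>)"
    have simple: "simple_module ?A (chain_factor ?P Ns i)"
      using Ns i by (simp add: composition_series_def)
    have "basis_fun (partial_id (sum_list \<alpha>)) \<odot>\<^bsub>chain_factor ?P Ns i\<^esub> x = \<zero>\<^bsub>chain_factor ?P Ns i\<^esub>"
      if x: "x \<in> carrier (chain_factor ?P Ns i)" for x
    proof (rule chain_factor_annihilated[OF _ Ns i _ _ x])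
      show "left_module ?A ?P" unfolding P by (rule left_module_tensor)
      show "basis_fun (partial_id (sum_list \<alpha>)) \<in> carrier ?A"
        using partial_id_closed[OF assms(2)] by (auto simp: monoid_algebra_simps basis_fun_def \<alpha>)
      show "basis_fun (partial_id (sum_list \<alpha>)) \<odot>\<^bsub>?P\<^esub> x = \<zero>\<^bsub>?P\<^esub>" if "x \<in> carrier ?P" for x
        using that partial_id_annihilates[OF \<beta>(2) assms(6,2)] unfolding P \<alpha> by blast
    qed
    then have "carrier (chain_factor ?P Ns i) = {\<zero>\<^bsub>chain_factor ?P Ns i\<^esub>}"
      using simple assms(2) \<alpha> iso
      by (intro trivial_if_isomorphic_PT_simple[of \<alpha> n]) (auto simp: simple_module_def)
    then show False using simple by (simp add: simple_module_def)
  qed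
  then have "{i. Suc i < length Ns \<and> module_isomorphic ?A (chain_factor ?P Ns i) (PT_simple n \<alpha>)} = {}"
    by blast
  then show ?thesis
    unfolding PT_cartan_matrix_def cartan_matrix_def jh_multiplicity_def Let_def Ns_def[symmetric]
    by (simp only: card.empty)
qed

end
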